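(* Let $\Omega\subset\mathbb{R}^3$ be a bounded open set whose boundary $\Gamma=\partial\Omega$ is a $C^2$ surface, let $\epsilon>0$ be small, and let $\mu\in\mathbb{R}$. Let $L=L(x,q,\mathbf{p}):\Gamma\times\mathbb{R}\times\mathbb{R}^3\to\mathbb{R}$ be twice continuously differentiable and satisfy $L_{\mathbf{p}}(x,q,\mathbf{t})\cdot\mathbf{n}(x)=0$ for any vector $\mathbf{t}$ tangent to $\Gamma$ at $x$. Suppose that the Euler--Lagrange equation $\delta I_\Gamma[u]=0$, $$-\nabla_\Gamma\cdot L_{\mathbf{p}}(x,u,\nabla_\Gamma u)+L_q(x,u,\nabla_\Gamma u)=0\quad\text{on }\Gamma,$$ is solvable, and that the extended problem $\delta\tilde I_{T_\epsilon}[v]=0$ with the Neumann boundary condition, $$-\nabla\cdot\bigl(J A\,L_{\mathbf{p}}(P_\Gamma z,v,A\nabla v)\bigr)+J\,L_q(P_\Gamma z,v,A\nabla v)=0\ \text{ in } T_\epsilon,\qquad \frac{\partial v}{\partial n}=0\ \text{ on }\partial T_\epsilon,$$ has the unique solution $v$. Then $v$ is constant-along-normal, i.e. $v(z)=v(P_\Gamma z)$ for all $z\in T_\epsilon$, and the restriction of $v$ to $\Gamma$ is the unique solution of $\delta I_\Gamma[u]=0$.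
   Context: Notation. $d_\Gamma$ is the signed distance function to $\Gamma$ (negative in $\Omega$, positive outside $\overline{\Omega}$). $T_\epsilon=\{z\in\mathbb{R}^3:|d_\Gamma(z)|<\epsilon\}$. $P_\Gamma z$ is the closest point of $\Gamma$ to $z$; $\epsilon$ is taken small enough (in particular $\epsilon\kappa_\infty<1$, where $\kappa_\infty$ is an upper bound of the curvatures of $\Gamma$) that $P_\Gamma$ is well defined on $T_\epsilon$. $\mathbf{n}(z)=\nabla d_\Gamma(z)$, which equals the outward unit normal of $\Gamma$ at $P_\Gamma z$, and $\frac{\partial v}{\partial n}=\mathbf{n}\cdot\nabla v$. $\nabla_\Gamma$ and $\nabla_\Gamma\cdot$ are the surface gradient and surface divergence on $\Gamma$; $\nabla_\Gamma u$ is viewed as a vector in $\mathbb{R}^3$ tangent to $\Gamma$. For $z\in T_\epsilon$ let $\mathbf{t}_1,\mathbf{t}_2$ be orthonormal principal directions of $\Gamma$ at $P_\Gamma z$ with principal curvatures $\kappa_1,\kappa_2$ (signed so that $\partial_{\mathbf{t}_i}\mathbf{n}=\kappa_i\mathbf{t}_i$ on $\Gamma$). Put $\sigma_i(z)=(1+d_\Gamma(z)\kappa_i(P_\Gamma z))^{-1}$; these are the two largest singular values of $DP_\Gamma(z)$. Set $J(z)=\sigma_1(z)\sigma_2(z)$ and $$A(z)=A(z;\mu)=\sigma_1^{-1}\,\mathbf{t}_1\otimes\mathbf{t}_1+\sigma_2^{-1}\,\mathbf{t}_2\otimes\mathbf{t}_2+\mu\,\mathbf{n}\otimes\mathbf{n}.$$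 $L_q$ and $L_{\mathbf{p}}$ denote the partial derivative of $L$ in $q$ and the gradient of $L$ in $\mathbf{p}$. The energies are $$I_\Gamma[u]=\int_\Gamma L(x,u,\nabla_\Gamma u)\,dS,\qquad \tilde I_{T_\epsilon}[v]=\frac1{2\epsilon}\int_{T_\epsilon}L(P_\Gamma z,v(z),A(z)\nabla v(z))\,J(z)\,dz ,$$ and $\delta I_\Gamma[u]=0$, $\delta\tilde I_{T_\epsilon}[v]=0$ denote the Euler--Lagrange equations displayed in the claim. Solutions of the surface equation are $C^2$ functions on $\Gamma$. *)

theory Defs
  imports "HOL-Analysis.Analysis"
begin

section \<open>Differentiability classes\<close>

definition gradient_within :: "('a::euclidean_space \<Rightarrow> real) \<Rightarrow> 'a \<Rightarrow> 'a set \<Rightarrow> 'a" where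
  "gradient_within f x S = (THE g. (f has_derivative (\<lambda>h. h \<bullet> g)) (at x within S))"

abbreviation gradient :: "('a::euclidean_space \<Rightarrow> real) \<Rightarrow> 'a \<Rightarrow> 'a" where
  "gradient f x \<equiv> gradient_within f x UNIV"

text \<open>Meant for open sets U: f is C^(k+1) iff it is differentiable and its first-order partial
  derivatives (the coordinates of the gradient) are C^k.\<close>

primrec Ck_open :: "nat \<Rightarrow> ('a::euclidean_space \<Rightarrow> real) \<Rightarrow> 'a set \<Rightarrow> bool" where
  "Ck_open 0 f U \<longleftrightarrow> continuous_on U f"
| "Ck_open (Suc k) f U \<longleftrightarrow>
     (\<exists>g. (\<forall>x\<in>U. GDERIV f x :> g x) \<and> (\<forall>i\<in>Basis. Ck_open k (\<lambda>x. g x \<bullet> i) U))"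

text \<open>On an arbitrary set S, C^k means locally extendable to a C^k function on an open set.  For a
  C^2 surface S and k \<le> 2 this is the class C^k in local charts; for the closure of a domain with
  C^1 boundary and k = 1 it is the usual class C^1 up to the boundary.\<close>

definition Ck_on :: "nat \<Rightarrow> ('a::euclidean_space \<Rightarrow> real) \<Rightarrow> 'a set \<Rightarrow> bool" where
  "Ck_on k f S \<longleftrightarrow>
     (\<forall>x\<in>S. \<exists>U F. open U \<and> x \<in> U \<and> Ck_open k F U \<and> (\<forall>y\<in>U \<inter> S. F y = f y))"

text \<open>The boundary is locally a regular C^2 level set with the domain on exactly one side, so that
  the outward normal exists.\<close>

definition C2_boundary :: "'a::euclidean_space set \<Rightarrow> bool" where
  "C2_boundary \<Omega> \<longleftrightarrow>
     (\<forall>x\<in>frontier \<Omega>. \<exists>U \<phi>. open U \<and> x \<in> U \<and> Ck_open 2 \<phi> U \<and> (\<forall>y\<in>U. gradient \<phi> y \<noteq> 0) \<and>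
        frontier \<Omega> \<inter> U = {y\<in>U. \<phi> y = 0} \<and> \<Omega> \<inter> U = {y\<in>U. \<phi> y < 0})"

section \<open>Geometry of the surface and of its tubular neighbourhood\<close>

definition signed_dist :: "(real^3) set \<Rightarrow> real^3 \<Rightarrow> real" where
  "signed_dist \<Omega> z =
     (if z \<in> \<Omega> then - infdist z (frontier \<Omega>) else infdist z (frontier \<Omega>))"

definition tube :: "(real^3) set \<Rightarrow> real \<Rightarrow> (real^3) set" where
  "tube \<Omega> \<epsilon> = {z. \<bar>signed_dist \<Omega> z\<bar> < \<epsilon>}"

definition proj :: "(real^3) set \<Rightarrow> real^3 \<Rightarrow> real^3" where
  "proj \<Omega> z = closest_point (frontier \<Omega>) z"

definition proj_well_defined_on :: "(real^3) set \<Rightarrow> (real^3) set \<Rightarrow> bool" where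
  "proj_well_defined_on \<Omega> S \<longleftrightarrow>
     (\<forall>z\<in>S. \<exists>!x. x \<in> frontier \<Omega> \<and> (\<forall>y\<in>frontier \<Omega>. dist z x \<le> dist z y))"

definition normal :: "(real^3) set \<Rightarrow> real^3 \<Rightarrow> real^3" where
  "normal \<Omega> z = gradient (signed_dist \<Omega>) z"

definition principal_frame ::
    "(real^3) set \<Rightarrow> real^3 \<Rightarrow> real^3 \<Rightarrow> real^3 \<Rightarrow> real \<Rightarrow> real \<Rightarrow> bool" where
  "principal_frame \<Omega> x a b k l \<longleftrightarrow>
     norm a = 1 \<and> norm b = 1 \<and> a \<bullet> b = 0 \<and> a \<bullet> normal \<Omega> x = 0 \<and> b \<bullet> normal \<Omega> x = 0 \<and>
     ((\<lambda>s. normal \<Omega> (x + s *\<^sub>R a)) has_vector_derivative k *\<^sub>R a) (at 0) \<and>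
     ((\<lambda>s. normal \<Omega> (x + s *\<^sub>R b)) has_vector_derivative l *\<^sub>R b) (at 0)"

definition sing_val :: "(real^3) set \<Rightarrow> (real^3 \<Rightarrow> real) \<Rightarrow> real^3 \<Rightarrow> real" where
  "sing_val \<Omega> \<kappa> z = inverse (1 + signed_dist \<Omega> z * \<kappa> (proj \<Omega> z))"

definition Jac :: "(real^3) set \<Rightarrow> (real^3 \<Rightarrow> real) \<Rightarrow> (real^3 \<Rightarrow> real) \<Rightarrow> real^3 \<Rightarrow> real" where
  "Jac \<Omega> \<kappa>1 \<kappa>2 z = sing_val \<Omega> \<kappa>1 z * sing_val \<Omega> \<kappa>2 z"

definition tensor :: "real^3 \<Rightarrow> real^3 \<Rightarrow> real^3^3" where
  "tensor a b = (\<chi> i j. a $ i * b $ j)"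

definition Amat ::
    "(real^3) set \<Rightarrow> (real^3 \<Rightarrow> real^3) \<Rightarrow> (real^3 \<Rightarrow> real^3) \<Rightarrow> (real^3 \<Rightarrow> real) \<Rightarrow> (real^3 \<Rightarrow> real)
      \<Rightarrow> real \<Rightarrow> real^3 \<Rightarrow> real^3^3" where
  "Amat \<Omega> t1 t2 \<kappa>1 \<kappa>2 \<mu> z =
     inverse (sing_val \<Omega> \<kappa>1 z) *\<^sub>R tensor (t1 (proj \<Omega> z)) (t1 (proj \<Omega> z)) +
     inverse (sing_val \<Omega> \<kappa>2 z) *\<^sub>R tensor (t2 (proj \<Omega> z)) (t2 (proj \<Omega> z)) +
     \<mu> *\<^sub>R tensor (normal \<Omega> z) (normal \<Omega> z)"

text \<open>The derivative of u along the surface determines its gradient up to a normal component, hence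
  the tangency condition.  The surface divergence of F is the sum over i of the i-th component of
  the surface gradient of the i-th component of F, i.e. the trace of its tangential derivative.\<close>

definition surf_grad :: "(real^3) set \<Rightarrow> (real^3 \<Rightarrow> real) \<Rightarrow> real^3 \<Rightarrow> real^3" where
  "surf_grad \<Omega> u x =
     (THE g. g \<bullet> normal \<Omega> x = 0 \<and> (u has_derivative (\<lambda>h. h \<bullet> g)) (at x within frontier \<Omega>))"

definition surf_div :: "(real^3) set \<Rightarrow> (real^3 \<Rightarrow> real^3) \<Rightarrow> real^3 \<Rightarrow> real" where
  "surf_div \<Omega> F x = (\<Sum>i\<in>UNIV. surf_grad \<Omega> (\<lambda>y. F y $ i) x $ i)"

section \<open>The two Euler--Lagrange problems\<close>

definition L_q :: "(real^3 \<Rightarrow> real \<Rightarrow> real^3 \<Rightarrow> real) \<Rightarrow> real^3 \<Rightarrow> real \<Rightarrow> real^3 \<Rightarrow> real" where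
  "L_q L x q p = deriv (\<lambda>s. L x s p) q"

definition L_p :: "(real^3 \<Rightarrow> real \<Rightarrow> real^3 \<Rightarrow> real) \<Rightarrow> real^3 \<Rightarrow> real \<Rightarrow> real^3 \<Rightarrow> real^3" where
  "L_p L x q p = gradient (\<lambda>r. L x q r) p"

definition surface_solution ::
    "(real^3) set \<Rightarrow> (real^3 \<Rightarrow> real \<Rightarrow> real^3 \<Rightarrow> real) \<Rightarrow> (real^3 \<Rightarrow> real) \<Rightarrow> bool" where
  "surface_solution \<Omega> L u \<longleftrightarrow>
     Ck_on 2 u (frontier \<Omega>) \<and>
     (\<forall>x\<in>frontier \<Omega>.
        - surf_div \<Omega> (\<lambda>y. L_p L y (u y) (surf_grad \<Omega> u y)) x
        + L_q L x (u x) (surf_grad \<Omega> u x) = 0)"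

definition test_function :: "'a::euclidean_space set \<Rightarrow> ('a \<Rightarrow> real) \<Rightarrow> bool" where
  "test_function T \<phi> \<longleftrightarrow>
     (\<forall>k. Ck_open k \<phi> UNIV) \<and> (\<exists>K. compact K \<and> K \<subseteq> T \<and> (\<forall>z. z \<notin> K \<longrightarrow> \<phi> z = 0))"

definition has_weak_divergence ::
    "('a::euclidean_space \<Rightarrow> 'a) \<Rightarrow> ('a \<Rightarrow> real) \<Rightarrow> 'a set \<Rightarrow> bool" where
  "has_weak_divergence F g T \<longleftrightarrow>
     (\<forall>K. compact K \<and> K \<subseteq> T \<longrightarrow> set_integrable lborel K F \<and> set_integrable lborel K g) \<and>
     (\<forall>\<phi>. test_function T \<phi> \<longrightarrow>
        (LINT z:T|lborel. F z \<bullet> gradient \<phi> z) = - (LINT z:T|lborel. g z * \<phi> z))"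

text \<open>For a C^2 surface the field J A is only continuous and the projection only C^1.  Hence even the
  constant-along-normal extension of a C^2 function is in general only C^1, and J A L_p need not be
  classically differentiable.  The natural solution class is therefore C^1 up to the boundary, with
  the divergence taken in the sense of distributions and the Neumann condition pointwise (on the
  boundary of the tube the gradient is the one-sided derivative within its closure).\<close>

definition extended_solution ::
    "(real^3) set \<Rightarrow> real \<Rightarrow> (real^3 \<Rightarrow> real^3) \<Rightarrow> (real^3 \<Rightarrow> real^3) \<Rightarrow> (real^3 \<Rightarrow> real) \<Rightarrow>
      (real^3 \<Rightarrow> real) \<Rightarrow> real \<Rightarrow> (real^3 \<Rightarrow> real \<Rightarrow> real^3 \<Rightarrow> real) \<Rightarrow> (real^3 \<Rightarrow> real) \<Rightarrow> bool" where
  "extended_solution \<Omega> \<epsilon> t1 t2 \<kappa>1 \<kappa>2 \<mu> L v \<longleftrightarrow>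
     (let T = tube \<Omega> \<epsilon>; J = Jac \<Omega> \<kappa>1 \<kappa>2; A = Amat \<Omega> t1 t2 \<kappa>1 \<kappa>2 \<mu> in
      Ck_on 1 v (closure T) \<and>
      has_weak_divergence
        (\<lambda>z. J z *\<^sub>R (A z *v L_p L (proj \<Omega> z) (v z) (A z *v gradient v z)))
        (\<lambda>z. J z * L_q L (proj \<Omega> z) (v z) (A z *v gradient v z)) T \<and>
      (\<forall>z\<in>frontier T. normal \<Omega> z \<bullet> gradient_within v z (closure T) = 0))"

end

theory Submission
  imports Defs
begin

text \<open>If \<open>u\<close> solves the surface equation, then \<open>w = u \<circ> P\<^sub>\<Gamma>\<close> solves the extended problem; by uniqueness
  \<open>w = v\<close>, which gives all claims at once.  Since \<open>A \<nabla>w = \<nabla>\<^sub>\<Gamma>u \<circ> P\<^sub>\<Gamma>\<close>, the point is the identity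
  \<open>div (J A (X \<circ> P\<^sub>\<Gamma>)) = J (div\<^sub>\<Gamma> X) \<circ> P\<^sub>\<Gamma>\<close> for a tangential \<open>C\<^sup>1\<close> field \<open>X\<close>, in the sense of distributions
  because \<open>J A\<close> is only continuous.  For \<open>0 < \<tau> \<le> 1\<close> the \<open>C\<^sup>1\<close> diffeomorphism
  \<open>\<Psi>\<^sub>\<tau>(z) = P\<^sub>\<Gamma> z + \<tau> d(z) n(z)\<close> squeezes the tube onto the tube of radius \<open>\<tau>\<epsilon>\<close>.  Integrating
  \<open>div ((\<phi> \<circ> \<Psi>\<^sub>\<tau>\<^sup>-\<^sup>1) (X \<circ> P\<^sub>\<Gamma>))\<close>, whose integral is zero, and changing variables gives, after division
  by \<open>\<tau>\<close>, an identity whose limit for \<open>\<tau> \<rightarrow> 0\<close> is the weak identity for the test function \<open>\<phi>\<close>.  No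
  surface measure is needed.\<close>

section \<open>Continuously differentiable maps\<close>

text \<open>Regularity of P and d is not given: from a C^2 boundary and uniqueness of the closest
  point on the closed tube it must be derived that both are C^1 on an open set containing the closed
  tube. The tube's boundary has to be included, because the Neumann condition lives there and the
  domination argument needs bounds on a compact set. The inequality \<epsilon> \<kappa>_max < 1
  makes the linearised problem invertible.

  The limit is not singular although the squeezing maps degenerate at \<tau> = 0. The Jacobian
  carries one factor \<tau> from the normal direction, which the division removes; the factor
  1/\<tau> in the derivative of \<phi> composed with the inverse map multiplies only the normal
  component of X, which is zero.

  A further obstacle is that principal directions and curvatures are chosen pointwise and need not
  be continuous; continuity of J and of J A X is obtained from expressions that do not mention the
  frame.\<close>

text \<open>The derivative is bundled as a bounded linear map, so its continuity is continuity in
  operator norm, the form that the inverse function theorem asks for. Values may be vectors, unlike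
  in \<open>Ck_open\<close>.\<close>

definition C1_on :: "('a::euclidean_space \<Rightarrow> 'b::euclidean_space) \<Rightarrow> 'a set \<Rightarrow> bool" where
  "C1_on f U \<longleftrightarrow>
     (\<exists>f'. (\<forall>x\<in>U. (f has_derivative blinfun_apply (f' x)) (at x)) \<and> continuous_on U f')"

lemma C1_onI:
  assumes "\<And>x. x \<in> U \<Longrightarrow> (f has_derivative blinfun_apply (f' x)) (at x)" "continuous_on U f'"
  shows "C1_on f U"
  using assms unfolding C1_on_def by blast

lemma C1_on_subset: "C1_on f U \<Longrightarrow> V \<subseteq> U \<Longrightarrow> C1_on f V"
  unfolding C1_on_def by (meson continuous_on_subset subsetD)

lemma C1_on_differentiable: "C1_on f U \<Longrightarrow> x \<in> U \<Longrightarrow> f differentiable at x"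
  unfolding C1_on_def differentiable_def by blast

lemma C1_on_imp_continuous_on: "C1_on f U \<Longrightarrow> continuous_on U f"
  by (meson C1_on_differentiable continuous_at_imp_continuous_on differentiable_imp_continuous_within)

text \<open>Derivatives chosen locally need not come from one choice. The Frechet derivative is a
  canonical one that agrees with each of them by uniqueness, so its continuity can be checked
  locally.\<close>

lemma C1_on_local:
  assumes "\<And>x. x \<in> U \<Longrightarrow> \<exists>V g. open V \<and> x \<in> V \<and> C1_on g V \<and> (\<forall>y\<in>V. g y = f y)"
  shows "C1_on f U"
proof -
  define f' where "f' x = Blinfun (frechet_derivative f (at x))" for x
  have *: "\<exists>V. open V \<and> x \<in> V \<and> (\<forall>y\<in>V. (f has_derivative blinfun_apply (f' y)) (at y)) \<and> continuous_on V f'"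
    if "x \<in> U" for x
  proof -
    obtain V g where V: "open V" "x \<in> V" "C1_on g V" "\<forall>y\<in>V. g y = f y"
      using assms \<open>x \<in> U\<close> by blast
    then obtain g' where g': "\<And>y. y \<in> V \<Longrightarrow> (g has_derivative blinfun_apply (g' y)) (at y)"
        "continuous_on V g'"
      unfolding C1_on_def by blast
    have d: "(f has_derivative blinfun_apply (g' y)) (at y)" if "y \<in> V" for y
      using has_derivative_transform_within_open[OF g'(1)[OF that] V(1) that] V(4) by auto
    have eq: "f' y = g' y" if "y \<in> V" for y
    proof -
      have "frechet_derivative f (at y) = blinfun_apply (g' y)"
        using frechet_derivative_at[OF d[OF that]] by simp
      then show ?thesis unfolding f'_def by (simp add: blinfun_apply_inverse)
    qed
    show ?thesis
      using V(1,2) d eq g'(2) continuous_on_cong[of V V f' g'] by (intro exI[of _ V]) auto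
  qed
  show ?thesis
  proof (rule C1_onI)
    show "(f has_derivative blinfun_apply (f' x)) (at x)" if "x \<in> U" for x
      using *[OF that] by blast
    have "continuous (at x) f'" if "x \<in> U" for x
      using *[OF that] continuous_on_eq_continuous_at by blast
    then show "continuous_on U f'"
      by (simp add: continuous_at_imp_continuous_on)
  qed
qed

lemma C1_on_transform:
  assumes "C1_on g U" "open U" "\<And>y. y \<in> U \<Longrightarrow> f y = g y"
  shows "C1_on f U"
  using assms by (intro C1_on_local) metis

lemma C1_on_linear:
  assumes "bounded_linear f" shows "C1_on f U"
  by (rule C1_onI[where f' = "\<lambda>_. Blinfun f"])
     (simp_all add: assms bounded_linear_Blinfun_apply bounded_linear_imp_has_derivative)

lemma C1_on_const: "C1_on (\<lambda>_. c) U"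
  by (rule C1_onI[where f' = "\<lambda>_. 0"]) (simp_all add: zero_blinfun.rep_eq)

lemma C1_on_ident: "C1_on (\<lambda>x. x) U"
  by (rule C1_on_linear) simp

lemma C1_on_compose:
  assumes "C1_on f U" "C1_on g V" "f ` U \<subseteq> V"
  shows "C1_on (\<lambda>x. g (f x)) U"
proof -
  obtain f' g' where *: "\<forall>x\<in>U. (f has_derivative blinfun_apply (f' x)) (at x)" "continuous_on U f'"
      "\<forall>x\<in>V. (g has_derivative blinfun_apply (g' x)) (at x)" "continuous_on V g'"
    using assms unfolding C1_on_def by blast
  show ?thesis
  proof (rule C1_onI[where f' = "\<lambda>x. g' (f x) o\<^sub>L f' x"])
    show "((\<lambda>x. g (f x)) has_derivative blinfun_apply (g' (f x) o\<^sub>L f' x)) (at x)" if "x \<in> U" for x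
      using has_derivative_compose[of f "f' x" x UNIV g "g' (f x)"] * that assms(3)
      by (auto simp: blinfun_compose.rep_eq o_def image_subset_iff)
    have "continuous_on U (\<lambda>x. g' (f x))"
      using continuous_on_compose2[OF *(4) C1_on_imp_continuous_on[OF assms(1)]] assms(3) by blast
    then show "continuous_on U (\<lambda>x. g' (f x) o\<^sub>L f' x)"
      by (intro continuous_intros *)
  qed
qed

lemma C1_on_Pair:
  assumes "C1_on f U" "C1_on g U"
  shows "C1_on (\<lambda>x. (f x, g x)) U"
proof -
  obtain f' g' where *: "\<forall>x\<in>U. (f has_derivative blinfun_apply (f' x)) (at x)" "continuous_on U f'"
      "\<forall>x\<in>U. (g has_derivative blinfun_apply (g' x)) (at x)" "continuous_on U g'"
    using assms unfolding C1_on_def by blast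
  let ?i = "Blinfun (\<lambda>x. (x, 0)) :: 'b \<Rightarrow>\<^sub>L ('b \<times> 'c)"
  let ?j = "Blinfun (\<lambda>x. (0, x)) :: 'c \<Rightarrow>\<^sub>L ('b \<times> 'c)"
  have ij: "blinfun_apply ?i = (\<lambda>x. (x, 0))" "blinfun_apply ?j = (\<lambda>x. (0, x))"
    by (auto intro!: bounded_linear_Blinfun_apply bounded_linear_intros)
  show ?thesis
  proof (rule C1_onI[where f' = "\<lambda>x. (?i o\<^sub>L f' x) + (?j o\<^sub>L g' x)"])
    show "((\<lambda>x. (f x, g x)) has_derivative blinfun_apply ((?i o\<^sub>L f' x) + (?j o\<^sub>L g' x))) (at x)"
      if "x \<in> U" for x
      using has_derivative_Pair[of f "f' x" x UNIV g "g' x"] * that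
      by (simp add: plus_blinfun.rep_eq blinfun_compose.rep_eq o_def ij)
    show "continuous_on U (\<lambda>x. (?i o\<^sub>L f' x) + (?j o\<^sub>L g' x))"
      by (intro continuous_intros *)
  qed
qed

lemma C1_on_bilinear:
  assumes B: "bounded_bilinear B" and "C1_on f U" "C1_on g U"
  shows "C1_on (\<lambda>x. B (f x) (g x)) U"
proof -
  interpret B: bounded_bilinear B by fact
  obtain f' g' where *: "\<forall>x\<in>U. (f has_derivative blinfun_apply (f' x)) (at x)" "continuous_on U f'"
      "\<forall>x\<in>U. (g has_derivative blinfun_apply (g' x)) (at x)" "continuous_on U g'"
    using assms unfolding C1_on_def by blast
  have cf: "continuous_on U f" "continuous_on U g"
    using assms C1_on_imp_continuous_on by blast+
  have c: "continuous_on U (\<lambda>x. B.prod_left (g x))" "continuous_on U (\<lambda>x. B.prod_right (f x))"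
    using bounded_linear.continuous_on[OF B.bounded_linear_prod_left cf(2)]
      bounded_linear.continuous_on[OF B.bounded_linear_prod_right cf(1)] by simp_all
  show ?thesis
  proof (rule C1_onI[where f' = "\<lambda>x. (B.prod_right (f x) o\<^sub>L g' x) + (B.prod_left (g x) o\<^sub>L f' x)"])
    show "((\<lambda>x. B (f x) (g x)) has_derivative
        blinfun_apply ((B.prod_right (f x) o\<^sub>L g' x) + (B.prod_left (g x) o\<^sub>L f' x))) (at x)"
      if "x \<in> U" for x
      using B.FDERIV[of f "f' x" x UNIV g "g' x"] * that
      by (simp add: plus_blinfun.rep_eq blinfun_compose.rep_eq o_def)
    show "continuous_on U (\<lambda>x. (B.prod_right (f x) o\<^sub>L g' x) + (B.prod_left (g x) o\<^sub>L f' x))"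
      by (intro continuous_on_add c *
          bounded_bilinear.continuous_on[OF bounded_bilinear_blinfun_compose])
  qed
qed

lemma C1_on_linear_compose:
  assumes "C1_on f U" "bounded_linear g"
  shows "C1_on (\<lambda>x. g (f x)) U"
  using C1_on_compose[OF assms(1) C1_on_linear[OF assms(2)], of UNIV] by simp

lemma C1_on_add:
  assumes "C1_on f U" "C1_on g U" shows "C1_on (\<lambda>x. f x + g x) U"
  using C1_on_linear_compose[OF C1_on_Pair[OF assms], of "\<lambda>p. fst p + snd p"]
  by (simp add: bounded_linear_add bounded_linear_fst bounded_linear_snd)

lemma C1_on_minus: "C1_on f U \<Longrightarrow> C1_on (\<lambda>x. - f x) U"
  by (rule C1_on_linear_compose) (simp_all add: bounded_linear_minus bounded_linear_ident)

lemma C1_on_diff: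
  assumes "C1_on f U" "C1_on g U" shows "C1_on (\<lambda>x. f x - g x) U"
  using C1_on_add[OF assms(1) C1_on_minus[OF assms(2)]] by simp

lemmas C1_on_scaleR = C1_on_bilinear[OF bounded_bilinear_scaleR]
lemmas C1_on_inner = C1_on_bilinear[OF bounded_bilinear_inner]
lemmas C1_on_fst = C1_on_linear_compose[OF _ bounded_linear_fst]
lemmas C1_on_snd = C1_on_linear_compose[OF _ bounded_linear_snd]

lemma C1_on_sum:
  assumes "\<And>i. i \<in> I \<Longrightarrow> C1_on (f i) U"
  shows "C1_on (\<lambda>x. \<Sum>i\<in>I. f i x) U"
  using assms by (induction I rule: infinite_finite_induct) (auto intro: C1_on_const C1_on_add)

lemma C1_on_componentwise:
  assumes "\<And>i. i \<in> Basis \<Longrightarrow> C1_on (\<lambda>x. f x \<bullet> i) U"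
  shows "C1_on f U"
proof -
  have "C1_on (\<lambda>x. \<Sum>i\<in>Basis. (f x \<bullet> i) *\<^sub>R i) U"
    by (intro C1_on_sum C1_on_scaleR C1_on_const assms)
  then show ?thesis by (simp add: euclidean_representation)
qed

lemma C1_on_real_compose:
  fixes f :: "'a::euclidean_space \<Rightarrow> real"
  assumes "C1_on f U" and "\<And>x. x \<in> U \<Longrightarrow> (g has_field_derivative g' (f x)) (at (f x))"
    and "continuous_on (f ` U) g'"
  shows "C1_on (\<lambda>x. g (f x)) U"
proof (rule C1_on_compose[OF assms(1), where V = "f ` U"])
  show "C1_on g (f ` U)"
  proof (rule C1_onI[where f' = "\<lambda>x. blinfun_scaleR_left (g' x)"])
    show "(g has_derivative blinfun_apply (blinfun_scaleR_left (g' y))) (at y)" if "y \<in> f ` U" for y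
      using assms(2) that by (auto simp: has_field_derivative_def mult_commute_abs)
    show "continuous_on (f ` U) (\<lambda>x. blinfun_scaleR_left (g' x) :: real \<Rightarrow>\<^sub>L real)"
      using assms(3) by (intro continuous_intros) 
  qed
qed simp

lemma C1_on_norm:
  assumes "C1_on f U" and "\<And>x. x \<in> U \<Longrightarrow> f x \<noteq> 0"
  shows "C1_on (\<lambda>x. norm (f x)) U"
proof -
  have "C1_on (\<lambda>x. sqrt (f x \<bullet> f x)) U"
  proof (rule C1_on_real_compose[where f = "\<lambda>x. f x \<bullet> f x" and g = sqrt
        and g' = "\<lambda>t. inverse (sqrt t) / 2"])
    show "C1_on (\<lambda>x. f x \<bullet> f x) U" by (intro C1_on_inner assms)
    show "(sqrt has_real_derivative inverse (sqrt (f x \<bullet> f x)) / 2) (at (f x \<bullet> f x))" if "x \<in> U" for x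
      using assms(2)[OF that] by (intro DERIV_real_sqrt) simp
    show "continuous_on ((\<lambda>x. f x \<bullet> f x) ` U) (\<lambda>t. inverse (sqrt t) / 2)"
      using assms(2) by (intro continuous_intros) auto
  qed
  then show ?thesis by (simp add: norm_eq_sqrt_inner)
qed

lemma C1_on_inverse:
  fixes f :: "'a::euclidean_space \<Rightarrow> real"
  assumes "C1_on f U" and "\<And>x. x \<in> U \<Longrightarrow> f x \<noteq> 0"
  shows "C1_on (\<lambda>x. inverse (f x)) U"
proof (rule C1_on_real_compose[OF assms(1), where g = inverse and g' = "\<lambda>t. - (inverse t * inverse t)"])
  show "(inverse has_real_derivative - (inverse (f x) * inverse (f x))) (at (f x))" if "x \<in> U" for x
    using DERIV_inverse'[OF DERIV_ident] assms(2)[OF that] by (simp add: power2_eq_square)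
  show "continuous_on (f ` U) (\<lambda>t. - (inverse t * inverse t))"
    using assms(2) by (intro continuous_intros) auto
qed

section \<open>Gradients and their relation to the classes C^1 and C^2\<close>

lemma GDERIV_unique: "GDERIV f x :> a \<Longrightarrow> GDERIV f x :> b \<Longrightarrow> a = b"
  unfolding gderiv_def using has_derivative_unique[of f "\<lambda>h. h \<bullet> a" x "\<lambda>h. h \<bullet> b"]
  by (metis vector_eq_ldot)

lemma gradient_eqI: "GDERIV f x :> g \<Longrightarrow> gradient f x = g"
  unfolding gradient_within_def gderiv_def[symmetric]
  by (blast intro: the_equality GDERIV_unique)

lemma GDERIV_gradient:
  fixes f :: "'a::euclidean_space \<Rightarrow> real"
  assumes "f differentiable at x"
  shows "GDERIV f x :> gradient f x"
proof -
  obtain f' where f': "(f has_derivative f') (at x)" using assms unfolding differentiable_def by blast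
  then have l: "linear f'" using has_derivative_linear by blast
  have "f' = (\<lambda>h. h \<bullet> (\<Sum>i\<in>Basis. f' i *\<^sub>R i))"
  proof
    fix h
    have "f' h = f' (\<Sum>i\<in>Basis. (h \<bullet> i) *\<^sub>R i)" by (simp add: euclidean_representation)
    also have "\<dots> = (\<Sum>i\<in>Basis. (h \<bullet> i) *\<^sub>R f' i)"
      using l by (simp add: linear_sum linear_scale)
    finally show "f' h = h \<bullet> (\<Sum>i\<in>Basis. f' i *\<^sub>R i)"
      by (simp add: inner_sum_right mult.commute)
  qed
  with f' have "GDERIV f x :> (\<Sum>i\<in>Basis. f' i *\<^sub>R i)" unfolding gderiv_def by metis
  then show ?thesis using gradient_eqI by metis
qed

text \<open>The gradient is the Riesz representative of the derivative, and its coordinates are the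
  values of the derivative on \<open>Basis\<close>. This connects the coordinatewise class of the
  statement with the calculus above.\<close>

lemma Ck_open_1_iff_C1_on: "Ck_open 1 f U \<longleftrightarrow> C1_on f U"
proof
  assume "Ck_open 1 f U"
  then obtain g where g: "\<And>x. x \<in> U \<Longrightarrow> GDERIV f x :> g x"
      "\<And>i. i \<in> Basis \<Longrightarrow> continuous_on U (\<lambda>x. g x \<bullet> i)"
    by auto
  have "continuous_on U g" using g(2) continuous_on_componentwise by blast
  then show "C1_on f U"
    using g(1) by (intro C1_onI[where f' = "\<lambda>x. blinfun_inner_left (g x)"] continuous_intros)
      (auto simp: gderiv_def)
next
  assume C: "C1_on f U"
  then obtain f' where f': "\<And>x. x \<in> U \<Longrightarrow> (f has_derivative blinfun_apply (f' x)) (at x)"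
      "continuous_on U f'" unfolding C1_on_def by blast
  have g: "GDERIV f x :> gradient f x" if "x \<in> U" for x
    using C1_on_differentiable[OF C that] by (rule GDERIV_gradient)
  have "continuous_on U (\<lambda>x. gradient f x \<bullet> i)" for i
  proof (rule continuous_on_eq[where f = "\<lambda>x. blinfun_apply (f' x) i"])
    show "continuous_on U (\<lambda>x. blinfun_apply (f' x) i)" by (intro continuous_intros f')
    show "blinfun_apply (f' x) i = gradient f x \<bullet> i" if "x \<in> U" for x
      using has_derivative_unique[OF f'(1)[OF that] g[OF that, unfolded gderiv_def]]
      by (metis inner_commute)
  qed
  then show "Ck_open 1 f U" using g by (auto intro!: exI[of _ "gradient f"])
qed

lemma Ck_open_2D:
  assumes "Ck_open 2 f U" "open U"
  shows "C1_on (gradient f) U" "C1_on f U" "\<And>x. x \<in> U \<Longrightarrow> GDERIV f x :> gradient f x"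
proof -
  obtain g where g: "\<And>x. x \<in> U \<Longrightarrow> GDERIV f x :> g x"
      "\<And>i. i \<in> Basis \<Longrightarrow> Ck_open 1 (\<lambda>x. g x \<bullet> i) U"
    using assms by (auto simp: numeral_2_eq_2)
  have C: "C1_on g U"
    by (rule C1_on_componentwise) (use g(2) Ck_open_1_iff_C1_on in blast)
  have eq: "gradient f x = g x" if "x \<in> U" for x using g(1)[OF that] by (rule gradient_eqI)
  show "C1_on (gradient f) U" by (rule C1_on_transform[OF C assms(2) eq])
  show "C1_on f U"
    using g(1) C1_on_imp_continuous_on[OF C]
    by (intro C1_onI[where f' = "\<lambda>x. blinfun_inner_left (g x)"] continuous_intros)
      (auto simp: gderiv_def)
  show "GDERIV f x :> gradient f x" if "x \<in> U" for x using g(1) eq that by metis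
qed

section \<open>Inverse functions, orthonormal frames and integrals of derivatives\<close>

lemma blinfun_compose_id_left: "id_blinfun o\<^sub>L f = f"
  by (rule blinfun_eqI) simp

lemma blinfun_compose_id_right: "f o\<^sub>L id_blinfun = f"
  by (rule blinfun_eqI) simp

text \<open>Everything follows from
  \<open>B x - B x0 = B x o\<^sub>L ((A x0 - A x) o\<^sub>L B x0)\<close>: near x0 it bounds the
  norm of \<open>B x\<close> by twice that of \<open>B x0\<close>, and with this bound it shows
  convergence.\<close>

lemma continuous_on_blinfun_inverse:
  fixes A :: "'t::topological_space \<Rightarrow> 'a::real_normed_vector \<Rightarrow>\<^sub>L 'b::real_normed_vector"
    and B :: "'t \<Rightarrow> 'b \<Rightarrow>\<^sub>L 'a"
  assumes A: "continuous_on V A"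
    and inv: "\<And>x. x \<in> V \<Longrightarrow> A x o\<^sub>L B x = id_blinfun" "\<And>x. x \<in> V \<Longrightarrow> B x o\<^sub>L A x = id_blinfun"
  shows "continuous_on V B"
  unfolding continuous_on_def
proof
  fix x0 assume x0: "x0 \<in> V"
  define b where "b = norm (B x0)"
  have lim: "((\<lambda>x. norm (A x0 - A x)) \<longlongrightarrow> 0) (at x0 within V)"
  proof -
    have "(A \<longlongrightarrow> A x0) (at x0 within V)" using A x0 unfolding continuous_on_def by blast
    then have "((\<lambda>x. A x0 - A x) \<longlongrightarrow> A x0 - A x0) (at x0 within V)" by (intro tendsto_diff tendsto_const)
    then show ?thesis using tendsto_norm_zero by fastforce
  qed
  \<comment> \<open>The threshold makes \<open>?e * b\<close> at most 1/2, so the term containing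
    \<open>norm (B x)\<close> can be absorbed on the left; the \<open>+ 1\<close> covers b =
    0.\<close>
  have "eventually (\<lambda>x. norm (A x0 - A x) < 1 / (2 * (b + 1))) (at x0 within V)"
    by (rule order_tendstoD(2)[OF lim]) (simp add: b_def add_nonneg_pos)
  moreover have "eventually (\<lambda>x. x \<in> V) (at x0 within V)"
    by (simp add: eventually_at_filter)
  ultimately have "eventually (\<lambda>x. norm (B x - B x0) \<le> (2 * b * b) * norm (A x0 - A x)) (at x0 within V)"
  proof eventually_elim
    case (elim x)
    let ?e = "norm (A x0 - A x)"
    have "B x o\<^sub>L ((A x0 - A x) o\<^sub>L B x0) = (B x o\<^sub>L (A x0 o\<^sub>L B x0)) - ((B x o\<^sub>L A x) o\<^sub>L B x0)"
      by (rule blinfun_eqI) (simp add: blinfun.diff_left blinfun.diff_right)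
    then have eq: "B x - B x0 = B x o\<^sub>L ((A x0 - A x) o\<^sub>L B x0)"
      unfolding inv(1)[OF x0] inv(2)[OF elim(2)]
      by (metis blinfun_compose_id_left blinfun_compose_id_right)
    have 1: "norm (B x - B x0) \<le> norm (B x) * (?e * b)"
      unfolding eq b_def
      by (meson norm_blinfun_compose mult_left_mono norm_ge_zero order_trans)
    have "b \<ge> 0" by (simp add: b_def)
    then have "?e * b \<le> 1 / (2 * (b + 1)) * b" using elim(1) by (intro mult_right_mono) auto
    also have "\<dots> \<le> 1 / 2" using \<open>b \<ge> 0\<close> by (simp add: field_simps)
    finally have "norm (B x) * (?e * b) \<le> norm (B x) * (1/2)"
      by (intro mult_left_mono) auto
    with 1 have "norm (B x) \<le> 2 * b"
      using norm_triangle_ineq2[of "B x" "B x0"] unfolding b_def by linarith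
    then have "norm (B x) * (?e * b) \<le> (2 * b) * (?e * b)"
      using \<open>b \<ge> 0\<close> by (intro mult_right_mono) auto
    with 1 show ?case by (simp add: mult_ac)
  qed
  then have "((\<lambda>x. B x - B x0) \<longlongrightarrow> 0) (at x0 within V)"
    by (rule Lim_null_comparison) (use tendsto_mult_right_zero[OF lim] in auto)
  then show "(B \<longlongrightarrow> B x0) (at x0 within V)" using Lim_null by blast
qed

text \<open>The inverse function theorem supplies a differentiable inverse, and continuity of
  operator inversion makes its derivative continuous. Injectivity of \<open>f0\<close> is enough to
  check, since it yields the linear left inverse that the theorem asks for.\<close>

lemma C1_on_inverse_function:
  fixes f :: "'a::euclidean_space \<Rightarrow> 'a"
  assumes "open U" "C1_on f U" "x0 \<in> U" "(f has_derivative f0) (at x0)"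
    and inj: "\<And>h. f0 h = 0 \<Longrightarrow> h = 0"
  obtains U' V g where "open U'" "U' \<subseteq> U" "x0 \<in> U'" "open V" "f x0 \<in> V"
    "homeomorphism U' V f g" "C1_on g V"
proof -
  obtain f' where f': "\<And>x. x \<in> U \<Longrightarrow> (f has_derivative blinfun_apply (f' x)) (at x)"
      "continuous_on U f'"
    using assms(2) unfolding C1_on_def by blast
  have f0: "f0 = blinfun_apply (f' x0)"
    using has_derivative_unique assms(4) f'(1)[OF assms(3)] by blast
  have lin: "linear f0" using assms(4) has_derivative_linear by blast
  then have "inj f0" using inj linear_injective_0 by blast
  then obtain k where k: "linear k" "k \<circ> f0 = id" using linear_injective_left_inverse[OF lin] by blast
  then have kb: "blinfun_apply (Blinfun k) = k"
    by (simp add: bounded_linear_Blinfun_apply linear_conv_bounded_linear)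
  have inv: "Blinfun k o\<^sub>L f' x0 = id_blinfun"
    using k(2) by (intro blinfun_eqI) (simp add: kb f0[symmetric] fun_eq_iff)
  obtain U' V g g' where *: "open U'" "U' \<subseteq> U" "x0 \<in> U'" "open V" "f x0 \<in> V" "homeomorphism U' V f g"
    "\<And>y. y \<in> V \<Longrightarrow> (g has_derivative (g' y)) (at y)"
    "\<And>y. y \<in> V \<Longrightarrow> g' y = inv (blinfun_apply (f'(g y)))"
    "\<And>y. y \<in> V \<Longrightarrow> bij (blinfun_apply (f'(g y)))"
    using inverse_function_theorem[OF assms(1) f' assms(3) inv] by metis
  have g: "continuous_on V g" "g ` V = U'" using *(6) unfolding homeomorphism_def by auto
  have b: "blinfun_apply (Blinfun (g' y)) = g' y" if "y \<in> V" for y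
    using *(7)[OF that] by (simp add: bounded_linear_Blinfun_apply has_derivative_bounded_linear)
  have "C1_on g V"
  proof (rule C1_onI[where f' = "\<lambda>y. Blinfun (g' y)"])
    show "(g has_derivative blinfun_apply (Blinfun (g' y))) (at y)" if "y \<in> V" for y
      using *(7) b that by simp
    show "continuous_on V (\<lambda>y. Blinfun (g' y))"
    proof (rule continuous_on_blinfun_inverse)
      show "continuous_on V (\<lambda>y. f' (g y))"
        using continuous_on_compose2[OF f'(2) g(1)] g(2) *(2) by blast
      show "f' (g y) o\<^sub>L Blinfun (g' y) = id_blinfun" if "y \<in> V" for y
      proof (rule blinfun_eqI)
        have "f' (g y) (g' y i) = i" for i
          using *(9)[OF that] by (simp add: *(8)[OF that] bij_is_surj surj_f_inv_f)
        then show "(f' (g y) o\<^sub>L Blinfun (g' y)) i = id_blinfun i" for i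
          by (simp add: b[OF that])
      qed
      show "Blinfun (g' y) o\<^sub>L f' (g y) = id_blinfun" if "y \<in> V" for y
      proof (rule blinfun_eqI)
        have "g' y (f' (g y) i) = i" for i
          using *(9)[OF that] by (simp add: *(8)[OF that] bij_is_inj)
        then show "(Blinfun (g' y) o\<^sub>L f' (g y)) i = id_blinfun i" for i
          by (simp add: b[OF that])
      qed
    qed
  qed
  with * that show thesis by blast
qed

lemma orthonormal_expansion_3:
  fixes a b c :: "real^3"
  assumes "norm a = 1" "norm b = 1" "norm c = 1" "a \<bullet> b = 0" "a \<bullet> c = 0" "b \<bullet> c = 0"
  shows "h = (h \<bullet> a) *\<^sub>R a + (h \<bullet> b) *\<^sub>R b + (h \<bullet> c) *\<^sub>R c"
proof -
  have ne: "a \<noteq> b" "a \<noteq> c" "b \<noteq> c" using assms by (auto simp: norm_eq_1)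
  have z: "0 \<notin> {a,b,c}" using assms by auto
  have o: "pairwise orthogonal {a,b,c}"
    using assms by (auto simp: pairwise_def orthogonal_def inner_commute)
  then have "independent {a,b,c}" using z pairwise_orthogonal_independent by blast
  moreover have "card {a,b,c} = 3" using ne by simp
  ultimately have "span {a,b,c} = UNIV"
    using card_eq_dim[of "{a,b,c}" "UNIV :: (real^3) set"] by (auto simp: dim_UNIV)
  then have "(\<Sum>i\<in>{a,b,c}. (h \<bullet> i) *\<^sub>R i) = h"
    using orthonormal_basis_expand[OF o] assms by auto
  then show ?thesis using ne by (simp add: add.assoc)
qed

text \<open>With the frame as rows of Q the matrix is \<open>transpose Q ** (D ** Q)\<close>. Only
  the square of \<open>det Q\<close> enters, so no orientation of the frame has to be
  chosen.\<close>

lemma det_orthonormal_eigenbasis_3: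
  fixes a b c :: "real^3"
  assumes "norm a = 1" "norm b = 1" "norm c = 1" "a \<bullet> b = 0" "a \<bullet> c = 0" "b \<bullet> c = 0"
  shows "det (matrix (\<lambda>h. (k * (h \<bullet> a)) *\<^sub>R a + (l * (h \<bullet> b)) *\<^sub>R b + (m * (h \<bullet> c)) *\<^sub>R c)) = k * l * m"
    (is "det (matrix ?f) = _")
proof -
  define Q :: "real^3^3" where "Q = vector [a, b, c]"
  define D :: "real^3^3" where "D = (\<chi> i j. if i = j then vector [k, l, m] $ i else 0)"
  have Q: "Q $ 1 = a" "Q $ 2 = b" "Q $ 3 = c" by (simp_all add: Q_def)
  have "Q ** transpose Q = mat 1"
  proof -
    have "(Q ** transpose Q) $ i $ j = Q $ i \<bullet> Q $ j" for i j
      by (simp add: matrix_matrix_mult_def transpose_def inner_vec_def)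
    then show ?thesis
      using assms unfolding vec_eq_iff forall_3 by (simp add: Q mat_def norm_eq_1 inner_commute)
  qed
  then have 1: "det Q * det Q = 1" by (metis det_I det_mul det_transpose)
  have "matrix ?f = transpose Q ** (D ** Q)"
    unfolding vec_eq_iff
    by (simp add: matrix_def matrix_matrix_mult_def transpose_def D_def sum_3 forall_3 Q inner_axis inner_axis'
        vector_3 algebra_simps)
  moreover have "det D = k * l * m"
    by (simp add: D_def det_3)
  ultimately show ?thesis using 1 by (simp add: det_mul det_transpose)
qed

text \<open>The derivative in direction v is a limit of difference quotients, each of integral zero
  by translation invariance of Lebesgue measure; dominated convergence passes to the limit. This is
  the only form of the divergence theorem that is used.\<close>

lemma integral_derivative_compact_support:
  fixes f :: "'a::euclidean_space \<Rightarrow> real"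
  assumes C1: "\<And>x. (f has_derivative blinfun_apply (f' x)) (at x)" "continuous_on UNIV f'"
    and C: "compact C" "\<And>x. x \<notin> C \<Longrightarrow> f x = 0"
  shows "integrable lborel (\<lambda>x. f' x v)" "(LINT x|lborel. f' x v) = 0"
proof -
  have cf: "continuous_on UNIV f"
    using has_derivative_continuous_on[of UNIV f "\<lambda>x. blinfun_apply (f' x)"] C1(1) by simp
  have z: "f' x = 0" if "x \<notin> C" for x
  proof -
    have "(f has_derivative (\<lambda>_. 0)) (at x)"
      by (rule has_derivative_transform_within_open[where f = "\<lambda>_. 0" and s = "- C"])
        (use C that compact_imp_closed in auto)
    then have "blinfun_apply (f' x) = (\<lambda>_. 0)" using has_derivative_unique C1(1) by blast
    then show ?thesis by (intro blinfun_eqI) simp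
  qed
  obtain M where M: "norm (f' x) \<le> M" "M \<ge> 0" for x
  proof -
    have "compact (f' ` C)" using C1(2) C(1) compact_continuous_image continuous_on_subset by blast
    then obtain M where "\<And>y. y \<in> C \<Longrightarrow> norm (f' y) \<le> M" "M > 0"
      using compact_imp_bounded bounded_pos by (metis image_eqI)
    then show thesis using z that[of M] by (metis less_eq_real_def norm_zero)
  qed
  have int_f: "integrable lborel f"
  proof -
    have "integrable lborel (\<lambda>x. indicator C x *\<^sub>R f x)"
      by (rule borel_integrable_compact) (use C continuous_on_subset[OF cf] in auto)
    moreover have "(\<lambda>x. indicator C x *\<^sub>R f x) = f"
      by (rule ext) (use C(2) in \<open>auto simp: indicator_def\<close>)
    ultimately show ?thesis by simp
  qed
  define h where "h n = inverse (real (Suc n))" for n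
  define s where "s n x = (f (x + h n *\<^sub>R v) - f x) / h n" for n x
  have h: "h n > 0" "h n \<le> 1" for n unfolding h_def by (auto simp: field_simps)
  have tr: "integrable lborel (\<lambda>x. f (x + w)) \<and> (LINT x|lborel. f (x + w)) = (LINT x|lborel. f x)" for w
  proof -
    have m: "f \<in> borel_measurable lborel" using int_f by auto
    have i: "integrable (distr lborel borel ((+) w)) f" using int_f by (simp add: lborel_distr_plus)
    have "integrable lborel (\<lambda>x. f (w + x))"
      using i integrable_distr_eq[of "(+) w" lborel borel f] m by auto
    moreover have "(LINT x|lborel. f (w + x)) = (LINT x|distr lborel borel ((+) w). f x)"
      using m by (subst integral_distr) auto
    ultimately show ?thesis by (simp add: lborel_distr_plus add.commute)
  qed
  have s0: "(LINT x|lborel. s n x) = 0" for n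
    unfolding s_def using tr[of "h n *\<^sub>R v"] int_f by simp
  \<comment> \<open>As 0 < h n \<le> 1, a quotient can be nonzero only on C or where x + s v lies in
    C for some s in [0,1]. This compact set carries the dominating constant for all
    quotients.\<close>
  define C' where "C' = C \<union> (\<lambda>p. fst p - snd p *\<^sub>R v) ` (C \<times> {0..1})"
  have C': "compact C'"
    unfolding C'_def
    by (intro compact_Un C(1) compact_continuous_image compact_Times continuous_intros) auto
  have bound: "norm (s n x) \<le> indicator C' x *\<^sub>R (M * norm v)" for n x
  proof (cases "x \<in> C'")
    case True
    have "norm (f (x + h n *\<^sub>R v) - f x) \<le> M * norm (x + h n *\<^sub>R v - x)"
      by (rule differentiable_bound[where S = UNIV and f' = "\<lambda>x. blinfun_apply (f' x)"])
        (use C1 M in \<open>auto simp: norm_blinfun.rep_eq[symmetric]\<close>)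
    then show ?thesis using True h[of n] by (simp add: s_def field_simps)
  next
    case False
    then have "x \<notin> C" "x + h n *\<^sub>R v \<notin> C"
      using h[of n] unfolding C'_def by (force intro!: image_eqI[of _ _ "(x + h n *\<^sub>R v, h n)"])+
    then show ?thesis using C(2) False by (simp add: s_def)
  qed
  have lim: "(\<lambda>n. s n x) \<longlonglongrightarrow> f' x v" for x
  proof -
    have "((\<lambda>t. x + t *\<^sub>R v) has_derivative (\<lambda>t. t *\<^sub>R v)) (at 0)"
      by (auto intro!: derivative_eq_intros)
    then have "((\<lambda>t. f (x + t *\<^sub>R v)) has_derivative (\<lambda>t. f' x (t *\<^sub>R v))) (at 0)"
      using has_derivative_compose[of "\<lambda>t. x + t *\<^sub>R v" _ 0 UNIV f "f' x"] C1(1)[of x] by simp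
    then have "((\<lambda>t. f (x + t *\<^sub>R v)) has_real_derivative f' x v) (at 0)"
      by (simp add: has_field_derivative_def blinfun.scaleR_right mult_commute_abs)
    then have "((\<lambda>t. (f (x + t *\<^sub>R v) - f x) / t) \<longlongrightarrow> f' x v) (at 0)"
      by (simp add: DERIV_def)
    moreover have "filterlim h (at 0) sequentially"
      unfolding filterlim_at using h LIMSEQ_inverse_real_of_nat
      by (auto simp: h_def[abs_def] intro!: always_eventually)
    ultimately show ?thesis unfolding s_def by (rule filterlim_compose)
  qed
  have w: "integrable lborel (\<lambda>x. indicator C' x *\<^sub>R (M * norm v))"
    by (rule borel_integrable_compact[OF C']) auto
  have ms: "s n \<in> borel_measurable lborel" for n
    unfolding s_def using tr[of "h n *\<^sub>R v"] int_f by auto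
  have mf: "(\<lambda>x. f' x v) \<in> borel_measurable lborel"
    using borel_measurable_LIMSEQ_real[OF lim ms] by simp
  show "integrable lborel (\<lambda>x. f' x v)"
    by (rule integrable_dominated_convergence[where s = s, OF mf ms w]) (use lim bound in auto)
  have "(\<lambda>n. LINT x|lborel. s n x) \<longlonglongrightarrow> (LINT x|lborel. f' x v)"
    by (rule integral_dominated_convergence[where s = s, OF mf ms w]) (use lim bound in auto)
  then show "(LINT x|lborel. f' x v) = 0" using s0 LIMSEQ_unique[OF _ tendsto_const] by simp
qed

section \<open>Closest point and signed distance near the surface\<close>

locale C2_domain =
  fixes \<Omega> :: "(real^3) set"
  assumes open_domain: "open \<Omega>" and bounded_domain: "bounded \<Omega>" and nonempty_domain: "\<Omega> \<noteq> {}"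
    and C2_boundary: "C2_boundary \<Omega>"
begin

abbreviation "\<Gamma> \<equiv> frontier \<Omega>"
abbreviation "d \<equiv> signed_dist \<Omega>"
abbreviation "P \<equiv> proj \<Omega>"
abbreviation "n \<equiv> normal \<Omega>"

text \<open>Kept apart from \<open>proj\<close>, which returns some closest point even where there
  are several; with the predicate, uniqueness can be stated at a single point.\<close>

definition nearest :: "real^3 \<Rightarrow> real^3 \<Rightarrow> bool" where
  "nearest z x \<longleftrightarrow> x \<in> \<Gamma> \<and> (\<forall>y\<in>\<Gamma>. dist z x \<le> dist z y)"

text \<open>N extends the unit normal of \<Gamma> to a C^1 unit field on an open set of space. It
  points outward because \<phi> is negative in \<Omega> and its gradient is a positive multiple of
  N.\<close>

definition chart :: "(real^3) set \<Rightarrow> (real^3 \<Rightarrow> real) \<Rightarrow> (real^3 \<Rightarrow> real^3) \<Rightarrow> bool" where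
  "chart U \<phi> N \<longleftrightarrow> open U \<and> C1_on \<phi> U \<and> C1_on N U \<and>
     (\<forall>y\<in>U. norm (N y) = 1 \<and> (\<exists>c>0. GDERIV \<phi> y :> c *\<^sub>R N y)) \<and>
     \<Gamma> \<inter> U = {y\<in>U. \<phi> y = 0} \<and> \<Omega> \<inter> U = {y\<in>U. \<phi> y < 0}"

lemma compact_surface: "compact \<Gamma>"
  using bounded_domain by (simp add: compact_frontier_bounded)

lemma surface_nonempty: "\<Gamma> \<noteq> {}"
  using nonempty_domain bounded_domain not_bounded_UNIV frontier_eq_empty by blast

lemma nearest_proj: "nearest z (P z)"
  unfolding nearest_def proj_def
  using closest_point_exists[OF frontier_closed surface_nonempty] by blast

lemma proj_in_surface: "P z \<in> \<Gamma>"
  using nearest_proj nearest_def by blast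

lemma nearest_imp_infdist:
  assumes "nearest z x" shows "infdist z \<Gamma> = dist z x"
proof (rule antisym)
  show "infdist z \<Gamma> \<le> dist z x" using assms by (simp add: infdist_le nearest_def)
  show "dist z x \<le> infdist z \<Gamma>"
    using assms surface_nonempty unfolding infdist_def nearest_def by (auto intro: cINF_greatest)
qed

lemma nearest_self: "x \<in> \<Gamma> \<Longrightarrow> nearest x y \<longleftrightarrow> y = x"
  unfolding nearest_def by (metis dist_eq_0_iff dist_le_zero_iff zero_le_dist)

lemma proj_surface [simp]: "x \<in> \<Gamma> \<Longrightarrow> P x = x"
  using nearest_proj nearest_self by blast

lemma abs_signed_dist: "\<bar>d z\<bar> = infdist z \<Gamma>"
  by (simp add: signed_dist_def infdist_nonneg)

lemma signed_dist_surface [simp]: "x \<in> \<Gamma> \<Longrightarrow> d x = 0"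
  using abs_signed_dist[of x] by simp

text \<open>The two branches live on the closed sets \<open>closure \<Omega>\<close> and
  \<open>- \<Omega>\<close>; these overlap in the boundary only, where the distance
  vanishes.\<close>

lemma continuous_signed_dist: "continuous_on UNIV d"
proof -
  have "continuous_on (closure \<Omega> \<union> - \<Omega>) d"
  proof (rule continuous_on_closed_Un)
    show "continuous_on (closure \<Omega>) d"
    proof (rule continuous_on_eq)
      show "continuous_on (closure \<Omega>) (\<lambda>z. - infdist z \<Gamma>)" by (intro continuous_intros)
      show "- infdist x \<Gamma> = d x" if "x \<in> closure \<Omega>" for x
        using that open_domain by (auto simp: signed_dist_def frontier_def interior_open)
    qed
    show "continuous_on (- \<Omega>) d"
    proof (rule continuous_on_eq)
      show "continuous_on (- \<Omega>) (\<lambda>z. infdist z \<Gamma>)" by (intro continuous_intros)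
    qed (simp add: signed_dist_def)
  qed (use open_domain in auto)
  moreover have "closure \<Omega> \<union> - \<Omega> = UNIV" using closure_subset by auto
  ultimately show ?thesis by simp
qed

lemma continuous_on_signed_dist: "continuous_on S d"
  using continuous_signed_dist continuous_on_subset by blast

lemma open_tube: "open (tube \<Omega> \<epsilon>)"
  unfolding tube_def by (intro open_Collect_less continuous_intros continuous_on_signed_dist)

lemma closure_tube_le: "z \<in> closure (tube \<Omega> \<epsilon>) \<Longrightarrow> \<bar>d z\<bar> \<le> \<epsilon>"
proof -
  have "closed {z. \<bar>d z\<bar> \<le> \<epsilon>}" by (intro closed_Collect_le continuous_intros continuous_on_signed_dist)
  then have "closure (tube \<Omega> \<epsilon>) \<subseteq> {z. \<bar>d z\<bar> \<le> \<epsilon>}"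
    by (rule closure_minimal[rotated]) (auto simp: tube_def)
  then show "z \<in> closure (tube \<Omega> \<epsilon>) \<Longrightarrow> \<bar>d z\<bar> \<le> \<epsilon>" by blast
qed

lemma surface_subset_tube: "\<epsilon> > 0 \<Longrightarrow> \<Gamma> \<subseteq> tube \<Omega> \<epsilon>"
  by (auto simp: tube_def)

lemma bounded_tube: "bounded (tube \<Omega> \<epsilon>)"
proof -
  obtain B where B: "\<And>x. x \<in> \<Gamma> \<Longrightarrow> norm x \<le> B"
    using compact_imp_bounded[OF compact_surface] bounded_iff by blast
  have "norm z \<le> B + \<epsilon>" if "z \<in> tube \<Omega> \<epsilon>" for z
  proof -
    have "dist z (P z) < \<epsilon>"
      using that nearest_imp_infdist[OF nearest_proj, of z] abs_signed_dist[of z] by (simp add: tube_def)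
    then show ?thesis using B[OF proj_in_surface, of z] norm_triangle_sub[of z "P z"] by (simp add: dist_norm)
  qed
  then show ?thesis unfolding bounded_iff by blast
qed

lemma compact_closure_tube: "compact (closure (tube \<Omega> \<epsilon>))"
  using bounded_tube by simp

section \<open>Local charts, normal lines and local behaviour of closest points\<close>

lemma chart_exists:
  assumes "x \<in> \<Gamma>"
  obtains U \<phi> N where "chart U \<phi> N" "x \<in> U"
proof -
  obtain U \<phi> where U: "open U" "x \<in> U" "Ck_open 2 \<phi> U" "\<forall>y\<in>U. gradient \<phi> y \<noteq> 0"
      "\<Gamma> \<inter> U = {y\<in>U. \<phi> y = 0}" "\<Omega> \<inter> U = {y\<in>U. \<phi> y < 0}"
    using bspec[OF C2_boundary[unfolded C2_boundary_def] assms] by (elim exE conjE)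
  define N where "N y = inverse (norm (gradient \<phi> y)) *\<^sub>R gradient \<phi> y" for y
  note \<phi> = Ck_open_2D[OF U(3,1)]
  have "C1_on N U"
    unfolding N_def using U(4) by (intro C1_on_scaleR C1_on_inverse C1_on_norm \<phi>(1)) auto
  moreover have "norm (N y) = 1 \<and> (\<exists>c>0. GDERIV \<phi> y :> c *\<^sub>R N y)" if "y \<in> U" for y
    using U(4) that \<phi>(3)[OF that] by (auto simp: N_def intro!: exI[of _ "norm (gradient \<phi> y)"])
  ultimately have "chart U \<phi> N" using U \<phi> unfolding chart_def by blast
  with U(2) that show thesis by blast
qed

lemma chartD:
  assumes "chart U \<phi> N"
  shows "open U" "C1_on \<phi> U" "C1_on N U" "y \<in> U \<Longrightarrow> norm (N y) = 1"
    "y \<in> U \<Longrightarrow> \<exists>c>0. GDERIV \<phi> y :> c *\<^sub>R N y"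
    "y \<in> U \<Longrightarrow> y \<in> \<Gamma> \<longleftrightarrow> \<phi> y = 0" "y \<in> U \<Longrightarrow> y \<in> \<Omega> \<longleftrightarrow> \<phi> y < 0"
  using assms unfolding chart_def by auto

text \<open>The open ball about z with x on its boundary misses \<Gamma>, so it stays on one side
  and \<phi> has a constant sign \<sigma> on its part in U. Hence the derivative of \<sigma> \<phi>
  at x is nonnegative in all directions pointing into the ball. They form an open half space, so the
  gradient is a nonnegative multiple of z - x. Differentiability of the distance is not
  presupposed.\<close>

lemma nearest_normal_line:
  assumes ch: "chart U \<phi> N" and near: "nearest z x" and x: "x \<in> U"
  shows "z = x + d z *\<^sub>R N x"
proof (cases "z \<in> \<Gamma>")
  case True
  then show ?thesis using near nearest_self by simp
next
  case False
  define r where "r = dist z x"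
  have xG: "x \<in> \<Gamma>" using near nearest_def by blast
  then have r: "r > 0" using False by (auto simp: r_def)
  have disj: "ball z r \<inter> \<Gamma> = {}" using near by (auto simp: nearest_def r_def)
  define \<sigma> :: real where "\<sigma> = (if z \<in> \<Omega> then -1 else 1)"
  have dz: "d z = \<sigma> * r"
    using nearest_imp_infdist[OF near] by (simp add: signed_dist_def \<sigma>_def r_def)
  have zb: "z \<in> ball z r" using r by simp
  have pos: "\<sigma> * \<phi> y > 0" if "y \<in> ball z r" "y \<in> U" for y
  proof -
    have "y \<notin> \<Gamma>" using that disj by blast
    then have "\<phi> y \<noteq> 0" using ch that unfolding chart_def by blast
    moreover have "y \<in> \<Omega> \<longleftrightarrow> z \<in> \<Omega>"
      using connected_Int_frontier[OF connected_ball, of z r \<Omega>] disj that(1) zb by blast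
    moreover have "y \<in> \<Omega> \<longleftrightarrow> \<phi> y < 0" using ch that(2) unfolding chart_def by blast
    ultimately show ?thesis by (auto simp: \<sigma>_def)
  qed
  have \<phi>x: "\<phi> x = 0" using ch x xG unfolding chart_def by blast
  obtain c where c: "c > 0" "GDERIV \<phi> x :> c *\<^sub>R N x" using ch x unfolding chart_def by blast
  define a where "a = (\<sigma> * c) *\<^sub>R N x"
  define m where "m = z - x"
  have m: "norm m = r" "m \<noteq> 0" using r by (auto simp: m_def r_def dist_norm)
  have half: "h \<bullet> a \<ge> 0" if h: "h \<bullet> m > 0" for h
  proof -
    let ?g = "\<lambda>t. \<sigma> * \<phi> (x + t *\<^sub>R h)"
    have "((\<lambda>t. x + t *\<^sub>R h) has_derivative (\<lambda>t. t *\<^sub>R h)) (at 0)" by (auto intro!: derivative_eq_intros)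
    then have "((\<lambda>t. \<phi> (x + t *\<^sub>R h)) has_derivative (\<lambda>t. (t *\<^sub>R h) \<bullet> (c *\<^sub>R N x))) (at 0)"
      using has_derivative_compose[of "\<lambda>t. x + t *\<^sub>R h" _ 0 UNIV \<phi>] c(2) unfolding gderiv_def by fastforce
    then have "(?g has_derivative (\<lambda>t. \<sigma> * ((t *\<^sub>R h) \<bullet> (c *\<^sub>R N x)))) (at 0)"
      by (rule has_derivative_mult_right)
    then have der: "(?g has_real_derivative (h \<bullet> a)) (at 0)"
      by (simp add: has_field_derivative_def a_def mult_commute_abs mult.left_commute mult.assoc)
    show ?thesis
    proof (rule ccontr)
      assume "\<not> h \<bullet> a \<ge> 0"
      then obtain e where e: "e > 0" "\<And>t. t > 0 \<Longrightarrow> t < e \<Longrightarrow> ?g t < ?g 0"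
        using DERIV_neg_dec_right[OF der] by auto
      have "open U" using ch chart_def by blast
      then have "\<forall>\<^sub>F t in at_right 0. x + t *\<^sub>R h \<in> U"
        using x by (intro topological_tendstoD[where l = x]) (auto intro!: tendsto_eq_intros)
      \<comment> \<open>Multiplied by t > 0, this says that t h - m has norm less than r, that is, x
        + t h lies in the ball.\<close>
      moreover have "\<forall>\<^sub>F t in at_right 0. t * (h \<bullet> h) < 2 * (h \<bullet> m)"
        using h by (intro order_tendstoD(2)[where y = 0]) (auto intro!: tendsto_eq_intros)
      moreover have "\<forall>\<^sub>F t in at_right (0::real). t < e" "\<forall>\<^sub>F t in at_right (0::real). t > 0"
        using e(1) eventually_at_right_less by (auto simp: eventually_at_right_field)
      ultimately have "\<forall>\<^sub>F t in at_right (0::real). False"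
      proof eventually_elim
        case (elim t)
        have "(norm (t *\<^sub>R h - m))\<^sup>2 = t * (t * (h \<bullet> h) - 2 * (h \<bullet> m)) + r\<^sup>2"
          using m(1) by (simp add: power2_norm_eq_inner inner_diff_left inner_diff_right inner_commute
              algebra_simps flip: m(1))
        also have "\<dots> < r\<^sup>2" using elim by (simp add: mult_pos_neg)
        finally have "norm (t *\<^sub>R h - m) < r" using r by (simp add: power_less_imp_less_base)
        then have "x + t *\<^sub>R h \<in> ball z r"
          by (simp add: dist_norm m_def algebra_simps norm_minus_commute)
        then have "?g t > 0" using pos elim by blast
        then show ?case using e(2)[of t] elim \<phi>x by simp
      qed
      then show False by simp
    qed
  qed
  define b where "b = a - ((a \<bullet> m) / (m \<bullet> m)) *\<^sub>R m"
  have bm: "b \<bullet> m = 0" using m(2) by (simp add: b_def inner_diff_left)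
  then have ba: "b \<bullet> a = b \<bullet> b" by (simp add: b_def inner_diff_right)
  have "b = 0"
  proof (rule ccontr)
    assume "b \<noteq> 0"
    \<comment> \<open>Tilting m along b keeps it in the half space because b is orthogonal to m;
      with this k the inner product of \<open>m - k *\<^sub>R b\<close> with a is -1, contradicting
      \<open>half\<close>.\<close>
    define k where "k = (m \<bullet> a + 1) / (b \<bullet> b)"
    have "(m - k *\<^sub>R b) \<bullet> m > 0" using bm m(2) by (simp add: inner_diff_left)
    then have "(m - k *\<^sub>R b) \<bullet> a \<ge> 0" by (rule half)
    then show False using \<open>b \<noteq> 0\<close> by (simp add: inner_diff_left ba k_def)
  qed
  then obtain q where q: "a = q *\<^sub>R m" unfolding b_def by (metis eq_iff_diff_eq_0)
  have mm: "m \<bullet> m > 0" using m(2) by simp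
  then have "q \<ge> 0"
    using half[OF mm, unfolded q inner_scaleR_right] by (meson mult_neg_pos not_le)
  have Nx: "norm (N x) = 1" using chartD(4)[OF ch x] .
  have \<sigma>: "\<sigma> * \<sigma> = 1" "\<bar>\<sigma>\<bar> = 1" by (auto simp: \<sigma>_def)
  have "norm a = c" using c(1) \<sigma> Nx by (simp add: a_def abs_mult)
  then have "c = q * r" using q \<open>q \<ge> 0\<close> m(1) by simp
  then have "q > 0" using c(1) r \<open>q \<ge> 0\<close> by (cases "q = 0") auto
  have "q *\<^sub>R (d z *\<^sub>R N x) = (\<sigma> * c) *\<^sub>R N x"
    using \<open>c = q * r\<close> by (simp add: dz mult_ac)
  then have "q *\<^sub>R (d z *\<^sub>R N x) = q *\<^sub>R m" using q a_def by metis
  then have "d z *\<^sub>R N x = m" using \<open>q > 0\<close> by (simp only: scaleR_cancel_left) simp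
  then show ?thesis by (simp add: m_def)
qed

text \<open>The points closer to \<Gamma> than to \<Gamma> - A form an open set, and compactness of
  \<Gamma> - A puts z0 into it. The conclusion concerns the value that P selects, so uniqueness is
  required at z0 alone.\<close>

lemma nearest_upper_semicontinuous:
  assumes "\<And>y. nearest z0 y \<Longrightarrow> y = x0" "open A" "x0 \<in> A"
  obtains V where "open V" "z0 \<in> V" "\<And>z. z \<in> V \<Longrightarrow> P z \<in> A"
proof (cases "\<Gamma> - A = {}")
  case True
  then show thesis using that[of UNIV] proj_in_surface by auto
next
  case False
  have K: "compact (\<Gamma> - A)" using compact_surface assms(2) by (simp add: compact_diff)
  let ?V = "{z. infdist z \<Gamma> < infdist z (\<Gamma> - A)}"
  show thesis
  proof (rule that)
    show "open ?V" by (intro open_Collect_less continuous_intros)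
    obtain y where y: "y \<in> \<Gamma> - A" "infdist z0 (\<Gamma> - A) = dist z0 y"
      using infdist_attains_inf[OF compact_imp_closed[OF K] False] by blast
    have "\<not> nearest z0 y" using assms y by blast
    then obtain w where "w \<in> \<Gamma>" "dist z0 w < dist z0 y" using y(1) unfolding nearest_def by force
    then show "z0 \<in> ?V" using y(2) infdist_le[of w \<Gamma> z0] by simp
    show "P z \<in> A" if "z \<in> ?V" for z
    proof (rule ccontr)
      assume "P z \<notin> A"
      then have "infdist z (\<Gamma> - A) \<le> dist z (P z)" by (intro infdist_le) (simp add: proj_in_surface)
      then show False using that nearest_imp_infdist[OF nearest_proj, of z] by simp
    qed
  qed
qed


text \<open>Differentiate z = P z + d z N(P z) and take the inner product with N(P z). P' is
  tangential because \<phi> vanishes along P, N' is orthogonal to N because N has length one, and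
  only the derivative of d survives. In particular the gradient of d is again C^1, one order better
  than what is put in.\<close>

lemma signed_dist_gderiv_chart:
  assumes ch: "chart U \<phi> N" and V: "open V" "z \<in> V" "C1_on P V" "C1_on d V" "P ` V \<subseteq> U"
  shows "GDERIV d z :> N (P z)"
proof -
  have Pz: "P z \<in> U" using V by blast
  obtain P' where P': "(P has_derivative P') (at z)"
    using C1_on_differentiable[OF V(3,2)] differentiable_def by blast
  obtain d' where d': "(d has_derivative d') (at z)"
    using C1_on_differentiable[OF V(4,2)] differentiable_def by blast
  obtain N' where N': "(N has_derivative N') (at (P z))"
    using C1_on_differentiable[OF chartD(3)[OF ch] Pz] unfolding differentiable_def by blast
  have U: "open U" using chartD(1)[OF ch] .
  obtain c where c: "c > 0" "(\<phi> has_derivative (\<lambda>h. h \<bullet> (c *\<^sub>R N (P z)))) (at (P z))"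
    using chartD(5)[OF ch Pz] unfolding gderiv_def by blast
  have NP: "((\<lambda>z. N (P z)) has_derivative (\<lambda>h. N' (P' h))) (at z)"
    by (rule has_derivative_compose[OF P' N'])
  have "((\<lambda>z. P z + d z *\<^sub>R N (P z)) has_derivative
      (\<lambda>h. P' h + (d z *\<^sub>R N' (P' h) + d' h *\<^sub>R N (P z)))) (at z)"
    by (intro has_derivative_add P' has_derivative_scaleR d' NP)
  then have "((\<lambda>z. z) has_derivative (\<lambda>h. P' h + (d z *\<^sub>R N' (P' h) + d' h *\<^sub>R N (P z)))) (at z)"
    by (rule has_derivative_transform_within_open[OF _ V(1,2)])
      (use nearest_normal_line[OF ch nearest_proj] V(5) in \<open>metis image_subset_iff\<close>)
  from has_derivative_unique[OF has_derivative_ident this]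
  have id: "h = P' h + (d z *\<^sub>R N' (P' h) + d' h *\<^sub>R N (P z))" for h by (rule fun_cong)
  have "((\<lambda>z. \<phi> (P z)) has_derivative (\<lambda>_. 0)) (at z)"
  proof (rule has_derivative_transform_within_open[OF has_derivative_const[of 0] V(1,2)])
    show "0 = \<phi> (P y)" if "y \<in> V" for y
      using chartD(6)[OF ch, of "P y"] that V(5) proj_in_surface by auto
  qed
  then have "(\<lambda>h. P' h \<bullet> (c *\<^sub>R N (P z))) = (\<lambda>_. 0)"
    using has_derivative_unique has_derivative_compose[OF P' c(2)] by blast
  then have tang: "P' h \<bullet> N (P z) = 0" for h
    using c(1) by (simp add: fun_eq_iff)
  have "((\<lambda>y. N y \<bullet> N y) has_derivative (\<lambda>_. 0)) (at (P z))"
  proof (rule has_derivative_transform_within_open[OF has_derivative_const[of 1] U Pz])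
    show "1 = N y \<bullet> N y" if "y \<in> U" for y
      using chartD(4)[OF ch that] by (simp add: norm_eq_1)
  qed
  then have "(\<lambda>h. N (P z) \<bullet> N' h + N' h \<bullet> N (P z)) = (\<lambda>_. 0)"
    using has_derivative_unique has_derivative_inner[OF N' N'] by blast
  then have N'N: "N' h \<bullet> N (P z) = 0" for h
    by (simp add: fun_eq_iff inner_commute)
  have NN: "N (P z) \<bullet> N (P z) = 1" using chartD(4)[OF ch Pz] by (simp add: norm_eq_1)
  have "h \<bullet> N (P z) = d' h" for h
    using arg_cong[OF id[of h], of "\<lambda>v. v \<bullet> N (P z)"] by (simp add: inner_add_left tang N'N NN)
  then have "d' = (\<lambda>h. h \<bullet> N (P z))" by auto
  with d' show ?thesis by (simp add: gderiv_def)
qed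

text \<open>The inverse function theorem applied to \<open>(y, s) \<mapsto> (y + s N(y), \<phi>(y))\<close>, whose inverse sends
  \<open>(z, 0)\<close> to the closest point and the signed distance of \<open>z\<close>.\<close>

lemma proj_C1_at_unique_nearest:
  assumes ch: "chart U \<phi> N" and x0: "x0 \<in> U" "nearest z0 x0"
    and uniq: "\<And>y. nearest z0 y \<Longrightarrow> y = x0"
    and N0: "(N has_derivative N0) (at x0)"
    and inj: "\<And>h k. h + d z0 *\<^sub>R N0 h + k *\<^sub>R N x0 = 0 \<Longrightarrow> h \<bullet> N x0 = 0 \<Longrightarrow> h = 0 \<and> k = 0"
  obtains V e where "open V" "z0 \<in> V" "C1_on P V" "C1_on d V" "P ` V \<subseteq> U" "e > 0"
    "\<And>s. \<bar>s - d z0\<bar> < e \<Longrightarrow> P (x0 + s *\<^sub>R N x0) = x0 \<and> d (x0 + s *\<^sub>R N x0) = s"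
proof -
  have U: "open U" and C1: "C1_on \<phi> U" "C1_on N U" using chartD[OF ch] by blast+
  obtain c where c: "c > 0" "(\<phi> has_derivative (\<lambda>h. h \<bullet> (c *\<^sub>R N x0))) (at x0)"
    using chartD(5)[OF ch x0(1)] unfolding gderiv_def by blast
  have z0: "z0 = x0 + d z0 *\<^sub>R N x0" by (rule nearest_normal_line[OF ch x0(2,1)])
  have surf: "\<phi> y = 0" if "y \<in> U" "y \<in> \<Gamma>" for y
    using chartD(6)[OF ch] that by blast
  have x0G: "x0 \<in> \<Gamma>" using x0 nearest_def by blast
  define H where "H p = (fst p + snd p *\<^sub>R N (fst p), \<phi> (fst p))" for p :: "(real^3) \<times> real"
  let ?p0 = "(x0, d z0)"
  have op: "open (U \<times> (UNIV :: real set))" using U by (intro open_Times) auto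
  have p0: "?p0 \<in> U \<times> UNIV" using x0 by simp
  have fst_in: "fst ` (U \<times> (UNIV :: real set)) \<subseteq> U" by auto
  have CH: "C1_on H (U \<times> UNIV)"
    unfolding H_def
    by (intro C1_on_Pair C1_on_add C1_on_scaleR C1_on_fst C1_on_snd C1_on_ident
        C1_on_compose[OF _ C1(1) fst_in] C1_on_compose[OF _ C1(2) fst_in])
  have N0': "(N has_derivative N0) (at (fst ?p0))" using N0 by simp
  have c': "(\<phi> has_derivative (\<lambda>h. h \<bullet> (c *\<^sub>R N x0))) (at (fst ?p0))" using c by simp
  have f1: "(fst has_derivative fst) (at ?p0)" and f2: "(snd has_derivative snd) (at ?p0)"
    by (auto intro!: derivative_eq_intros)
  have DH: "(H has_derivative (\<lambda>p. (fst p + (snd ?p0 *\<^sub>R N0 (fst p) + snd p *\<^sub>R N (fst ?p0)),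
      fst p \<bullet> (c *\<^sub>R N x0)))) (at ?p0)"
    unfolding H_def
    by (intro has_derivative_Pair has_derivative_add has_derivative_scaleR f1 f2
        has_derivative_compose[OF f1 N0'] has_derivative_compose[OF f1 c'])
  have injH: "p = 0" if "(fst p + (snd ?p0 *\<^sub>R N0 (fst p) + snd p *\<^sub>R N (fst ?p0)),
      fst p \<bullet> (c *\<^sub>R N x0)) = 0" for p
    using inj[of "fst p" "snd p"] that c(1) by (simp add: prod_eq_iff zero_prod_def add.assoc)
  obtain U' V' G where G: "open U'" "U' \<subseteq> U \<times> UNIV" "?p0 \<in> U'" "open V'" "H ?p0 \<in> V'"
      "homeomorphism U' V' H G" "C1_on G V'"
    using C1_on_inverse_function[OF op CH p0 DH injH] by blast
  have H0: "H (y, s) = (y + s *\<^sub>R N y, 0)" if "y \<in> U" "y \<in> \<Gamma>" for y s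
    using surf[OF that] by (simp add: H_def)
  have GH: "H p \<in> V' \<and> G (H p) = p" if "p \<in> U'" for p
    using G(6) that unfolding homeomorphism_def by blast
  obtain A B where AB: "open A" "open B" "x0 \<in> A" "d z0 \<in> B" "A \<times> B \<subseteq> U'"
    using open_prod_elim[OF G(1,3)] by (metis mem_Sigma_iff)
  have AU: "A \<subseteq> U" using AB G(2) by blast
  obtain V1 where V1: "open V1" "z0 \<in> V1" "\<And>z. z \<in> V1 \<Longrightarrow> P z \<in> A"
    using nearest_upper_semicontinuous[OF uniq AB(1,3)] by blast
  define V where "V = V1 \<inter> d -` B"
  have oV: "open V"
    unfolding V_def using V1(1) AB(2) continuous_signed_dist by (simp add: open_Int open_vimage)
  have z0V: "z0 \<in> V" using V1 AB by (simp add: V_def)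
  \<comment> \<open>The pair (P z, d z) lies in the domain of the local homeomorphism, and H sends
    it to (z, 0). So G returns exactly this pair, and P and d inherit their regularity from
    G.\<close>
  have G_eq: "(z, 0) \<in> V' \<and> G (z, 0) = (P z, d z)" if "z \<in> V" for z
  proof -
    have "P z \<in> A" "(P z, d z) \<in> U'" using that V1 AB(5) unfolding V_def by auto
    moreover have "z = P z + d z *\<^sub>R N (P z)"
      using nearest_normal_line[OF ch nearest_proj] \<open>P z \<in> A\<close> AU by blast
    ultimately show ?thesis using GH H0[of "P z" "d z"] AU proj_in_surface by (metis subsetD)
  qed
  have "C1_on (\<lambda>z. G (z, 0)) V"
    by (rule C1_on_compose[OF _ G(7)])
      (use G_eq in \<open>auto intro!: C1_on_Pair C1_on_ident C1_on_const\<close>)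
  then have "C1_on (\<lambda>z. (P z, d z)) V"
    by (rule C1_on_transform[OF _ oV]) (use G_eq in simp)
  then have C: "C1_on P V" "C1_on d V"
    using C1_on_fst C1_on_snd by fastforce+
  \<comment> \<open>Along the normal through x0 one has H (x0, s) = (x0 + s N(x0), 0), so P and d
    are explicit for s near d z0. This later lets normal segments be continued.\<close>
  let ?l = "\<lambda>s. x0 + s *\<^sub>R N x0"
  have "open (?l -` V \<inter> B)"
    by (intro open_Int AB open_vimage oV continuous_intros)
  moreover have "d z0 \<in> ?l -` V \<inter> B" using z0 z0V AB by simp
  ultimately obtain e where e: "e > 0" "ball (d z0) e \<subseteq> ?l -` V \<inter> B"
    using open_contains_ball by blast
  show thesis
  proof (rule that[OF oV z0V C _ e(1)])
    show "P ` V \<subseteq> U" using V1 AU unfolding V_def by blast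
    show "P (?l s) = x0 \<and> d (?l s) = s" if "\<bar>s - d z0\<bar> < e" for s
    proof -
      have "?l s \<in> V" "s \<in> B" using e(2) that by (auto simp: dist_real_def abs_minus_commute subset_iff)
      then have "G (H (x0, s)) = (P (?l s), d (?l s))" using H0[OF x0(1) x0G] G_eq by simp
      moreover have "(x0, s) \<in> U'" using AB \<open>s \<in> B\<close> by auto
      ultimately show ?thesis using GH by (metis prod.inject)
    qed
  qed
qed

section \<open>The domain of regularity of the projection, the signed distance and the normal
  field\<close>

definition regular :: "(real^3) set \<Rightarrow> bool" where
  "regular V \<longleftrightarrow> open V \<and> C1_on P V \<and> C1_on d V \<and> C1_on n V \<and>
     (\<forall>z\<in>V. GDERIV d z :> n z \<and> norm (n z) = 1 \<and> n (P z) = n z)"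

text \<open>The largest open set of regularity. As a union it gives one common domain for \<Gamma>
  and later for the closed tube, so that charts need not be chosen again.\<close>

definition "W = \<Union>{V. regular V}"

text \<open>On \<Gamma> the signed distance is zero, so the term with the derivative of N disappears
  from the linear condition, and x0 is its own only closest point. No curvature bound
  enters.\<close>

lemma surface_chart_neighbourhood:
  assumes ch: "chart U \<phi> N" and x0: "x0 \<in> U" "x0 \<in> \<Gamma>"
  shows "\<exists>V. open V \<and> x0 \<in> V \<and> C1_on P V \<and> C1_on d V \<and> P ` V \<subseteq> U"
proof -
  obtain N0 where N0: "(N has_derivative N0) (at x0)"
    using C1_on_differentiable[OF chartD(3)[OF ch] x0(1)] unfolding differentiable_def by blast
  have N1: "N x0 \<bullet> N x0 = 1" using chartD(4)[OF ch x0(1)] by (simp add: norm_eq_1)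
  have "h = 0 \<and> k = 0" if "h + d x0 *\<^sub>R N0 h + k *\<^sub>R N x0 = 0" "h \<bullet> N x0 = 0" for h k
  proof -
    have 1: "h + k *\<^sub>R N x0 = 0" using that(1) x0(2) by simp
    have "(h + k *\<^sub>R N x0) \<bullet> N x0 = k" using that(2) N1 by (simp add: inner_add_left)
    then have "k = 0" using 1 by simp
    then show ?thesis using 1 by simp
  qed
  then show ?thesis
    using proj_C1_at_unique_nearest[OF ch x0(1) _ _ N0, of x0] nearest_self[OF x0(2)] by metis
qed

lemma normal_eq_chart:
  assumes "chart U \<phi> N" "x \<in> U" "x \<in> \<Gamma>"
  shows "n x = N x"
proof -
  obtain V where "open V" "x \<in> V" "C1_on P V" "C1_on d V" "P ` V \<subseteq> U"
    using surface_chart_neighbourhood[OF assms] by blast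
  then have "GDERIV d x :> N (P x)" by (intro signed_dist_gderiv_chart[OF assms(1)])
  then show ?thesis unfolding normal_def using assms(3) by (simp add: gradient_eqI)
qed

lemma regularI:
  assumes ch: "chart U \<phi> N" and V: "open V" "C1_on P V" "C1_on d V" "P ` V \<subseteq> U"
  shows "regular V"
proof -
  have g: "GDERIV d z :> N (P z)" if "z \<in> V" for z
    by (rule signed_dist_gderiv_chart[OF ch V(1) that V(2-4)])
  then have nN: "n z = N (P z)" if "z \<in> V" for z
    unfolding normal_def using that by (simp add: gradient_eqI)
  have "C1_on (\<lambda>z. N (P z)) V"
    by (rule C1_on_compose[OF V(2) _ V(4)]) (use ch chart_def in blast)
  then have "C1_on n V" by (rule C1_on_transform[OF _ V(1) nN])
  moreover have "norm (n z) = 1 \<and> n (P z) = n z" if "z \<in> V" for z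
    using nN[OF that] ch V(4) that normal_eq_chart[OF ch _ proj_in_surface, of z]
    unfolding chart_def by auto
  ultimately show ?thesis unfolding regular_def using V g nN by simp
qed

lemma surface_subset_W: "\<Gamma> \<subseteq> W"
proof
  fix x assume "x \<in> \<Gamma>"
  moreover obtain U \<phi> N where "chart U \<phi> N" "x \<in> U" using chart_exists[OF \<open>x \<in> \<Gamma>\<close>] .
  ultimately show "x \<in> W" unfolding W_def using surface_chart_neighbourhood regularI by blast
qed

lemma regular_W: "regular W"
proof -
  have "\<exists>V\<subseteq>W. z \<in> V \<and> regular V" if "z \<in> W" for z using that unfolding W_def by blast
  note * = this
  have "\<exists>V. open V \<and> z \<in> V \<and> C1_on P V \<and> C1_on d V \<and> C1_on n V" if "z \<in> W" for z
    using *[OF that] unfolding regular_def by auto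
  then have "C1_on P W" "C1_on d W" "C1_on n W"
    by (intro C1_on_local; blast)+
  moreover have "open W" unfolding W_def regular_def by auto
  moreover have "GDERIV d z :> n z \<and> norm (n z) = 1 \<and> n (P z) = n z" if "z \<in> W" for z
    using *[OF that] unfolding regular_def by auto
  ultimately show ?thesis unfolding regular_def by simp
qed

lemma
  shows open_W: "open W" and proj_C1: "C1_on P W" and signed_dist_C1: "C1_on d W"
    and normal_C1: "C1_on n W"
    and signed_dist_gderiv: "z \<in> W \<Longrightarrow> GDERIV d z :> n z"
    and norm_normal: "z \<in> W \<Longrightarrow> norm (n z) = 1"
    and normal_proj: "z \<in> W \<Longrightarrow> n (P z) = n z"
  using regular_W unfolding regular_def by simp_all

lemma proj_in_W: "P z \<in> W"
  using surface_subset_W proj_in_surface by blast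

lemma normal_line: "z = P z + d z *\<^sub>R n (P z)"
proof -
  obtain U \<phi> N where "chart U \<phi> N" "P z \<in> U" using chart_exists[OF proj_in_surface] .
  then show ?thesis
    using nearest_normal_line[OF _ nearest_proj] normal_eq_chart[OF _ _ proj_in_surface] by metis
qed

section \<open>Derivatives of the projection and of the normal field\<close>

definition "P' z = frechet_derivative P (at z)"
definition "n' z = frechet_derivative n (at z)"

lemma proj_has_derivative: "z \<in> W \<Longrightarrow> (P has_derivative P' z) (at z)"
  unfolding P'_def using C1_on_differentiable[OF proj_C1] frechet_derivative_works by blast

lemma normal_has_derivative: "z \<in> W \<Longrightarrow> (n has_derivative n' z) (at z)"
  unfolding n'_def using C1_on_differentiable[OF normal_C1] frechet_derivative_works by blast

lemma normal_derivative_proj: "z \<in> W \<Longrightarrow> n' z h = n' (P z) (P' z h)"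
proof -
  assume z: "z \<in> W"
  have "((\<lambda>z. n (P z)) has_derivative (\<lambda>h. n' (P z) (P' z h))) (at z)"
    by (rule has_derivative_compose[OF proj_has_derivative[OF z] normal_has_derivative[OF proj_in_W]])
  then have "(n has_derivative (\<lambda>h. n' (P z) (P' z h))) (at z)"
    by (rule has_derivative_transform_within_open[OF _ open_W z normal_proj])
  then show ?thesis using has_derivative_unique[OF normal_has_derivative[OF z]] by metis
qed

text \<open>This is the derivative of z = P z + d z n(z). Combined with n' z = n' (P z) o P' z it
  becomes a linear equation for P' z, which is solved in the principal frame in
  \<open>proj_derivative\<close>.\<close>

lemma proj_derivative_identity:
  assumes z: "z \<in> W"
  shows "h = P' z h + d z *\<^sub>R n' z h + (h \<bullet> n z) *\<^sub>R n z"
proof -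
  have d': "(d has_derivative (\<lambda>h. h \<bullet> n z)) (at z)"
    using signed_dist_gderiv[OF z] by (simp add: gderiv_def)
  have "((\<lambda>z. P z + d z *\<^sub>R n z) has_derivative
      (\<lambda>h. P' z h + (d z *\<^sub>R n' z h + (h \<bullet> n z) *\<^sub>R n z))) (at z)"
    by (intro has_derivative_add has_derivative_scaleR d' proj_has_derivative normal_has_derivative z)
  then have "((\<lambda>z. z) has_derivative (\<lambda>h. P' z h + (d z *\<^sub>R n' z h + (h \<bullet> n z) *\<^sub>R n z))) (at z)"
    by (rule has_derivative_transform_within_open[OF _ open_W z])
      (use normal_line normal_proj in metis)
  from fun_cong[OF has_derivative_unique[OF has_derivative_ident this], of h]
  show ?thesis by (simp only: add.assoc)
qed

lemma proj_derivative_tangent: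
  assumes z: "z \<in> W" shows "P' z h \<bullet> n z = 0"
proof -
  have "(d has_derivative (\<lambda>h. h \<bullet> n (P z))) (at (P z))"
    using signed_dist_gderiv[OF proj_in_W] by (simp add: gderiv_def)
  then have "((\<lambda>z. d (P z)) has_derivative (\<lambda>h. P' z h \<bullet> n (P z))) (at z)"
    by (rule has_derivative_compose[OF proj_has_derivative[OF z]])
  then have "((\<lambda>_. 0 :: real) has_derivative (\<lambda>h. P' z h \<bullet> n (P z))) (at z)"
    by (simp add: proj_in_surface)
  then show ?thesis using has_derivative_unique[OF has_derivative_const] normal_proj[OF z] by metis
qed

lemma proj_derivative_surface: "x \<in> \<Gamma> \<Longrightarrow> P' x h = h - (h \<bullet> n x) *\<^sub>R n x"
  using proj_derivative_identity[of x h] surface_subset_W by (auto simp: algebra_simps)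

text \<open>Near x the field n is N o P, whereas N itself may differ from n off \<Gamma>. Since P' x
  fixes tangent vectors, the two derivatives agree on these.\<close>

lemma tangent_chart_derivative:
  assumes ch: "chart U \<phi> N" and x: "x \<in> U" "x \<in> \<Gamma>" and N': "(N has_derivative N') (at x)"
    and t: "t \<bullet> n x = 0"
  shows "N' t = n' x t"
proof -
  obtain V where V: "open V" "x \<in> V" "C1_on P V" "C1_on d V" "P ` V \<subseteq> U"
    using surface_chart_neighbourhood[OF ch x] by blast
  have xW: "x \<in> W" using x surface_subset_W by blast
  have "(N has_derivative N') (at (P x))" using N' x by simp
  then have "((\<lambda>z. N (P z)) has_derivative (\<lambda>h. N' (P' x h))) (at x)"
    by (rule has_derivative_compose[OF proj_has_derivative[OF xW]])
  then have "(n has_derivative (\<lambda>h. N' (P' x h))) (at x)"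
    by (rule has_derivative_transform_within_open[OF _ V(1,2)])
      (use gradient_eqI[OF signed_dist_gderiv_chart[OF ch V(1) _ V(3-5)]] in \<open>simp add: normal_def\<close>)
  then have "n' x = (\<lambda>h. N' (P' x h))" using has_derivative_unique[OF normal_has_derivative[OF xW]] by blast
  then show ?thesis using proj_derivative_surface[OF x(2), of t] t by simp
qed

end

section \<open>The tubular neighbourhood\<close>

locale tubular_neighbourhood = C2_domain +
  fixes \<epsilon> \<kappa>_max :: real and t1 t2 :: "real^3 \<Rightarrow> real^3" and \<kappa>1 \<kappa>2 :: "real^3 \<Rightarrow> real"
  assumes frame: "x \<in> frontier \<Omega> \<Longrightarrow> principal_frame \<Omega> x (t1 x) (t2 x) (\<kappa>1 x) (\<kappa>2 x)"
    and curvature_bound: "x \<in> frontier \<Omega> \<Longrightarrow> \<bar>\<kappa>1 x\<bar> \<le> \<kappa>_max \<and> \<bar>\<kappa>2 x\<bar> \<le> \<kappa>_max"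
    and \<epsilon>_pos: "\<epsilon> > 0" and \<epsilon>_small: "\<epsilon> * \<kappa>_max < 1"
    and proj_well_defined: "proj_well_defined_on \<Omega> (closure (tube \<Omega> \<epsilon>))"
begin

abbreviation "T \<equiv> tube \<Omega> \<epsilon>"
abbreviation "\<sigma>1 \<equiv> sing_val \<Omega> \<kappa>1"
abbreviation "\<sigma>2 \<equiv> sing_val \<Omega> \<kappa>2"

lemma frame_orthonormal:
  assumes "x \<in> \<Gamma>"
  shows "norm (t1 x) = 1" "norm (t2 x) = 1" "norm (n x) = 1"
    "t1 x \<bullet> t2 x = 0" "t1 x \<bullet> n x = 0" "t2 x \<bullet> n x = 0"
  using frame[OF assms] norm_normal[of x] surface_subset_W assms
  unfolding principal_frame_def by auto

lemma frame_derivative: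
  assumes x: "x \<in> \<Gamma>"
  shows "n' x (t1 x) = \<kappa>1 x *\<^sub>R t1 x" "n' x (t2 x) = \<kappa>2 x *\<^sub>R t2 x"
proof -
  have nd: "(n has_derivative n' x) (at x)" using normal_has_derivative x surface_subset_W by blast
  have *: "n' x a = k" if "((\<lambda>s. n (x + s *\<^sub>R a)) has_vector_derivative k) (at 0)" for a k
  proof -
    have "((\<lambda>s. x + s *\<^sub>R a) has_derivative (\<lambda>s. s *\<^sub>R a)) (at 0)"
      by (auto intro!: derivative_eq_intros)
    then have "((\<lambda>s. n (x + s *\<^sub>R a)) has_derivative (\<lambda>s. n' x (s *\<^sub>R a))) (at 0)"
      using has_derivative_compose[of "\<lambda>s. x + s *\<^sub>R a" "\<lambda>s. s *\<^sub>R a" 0 UNIV n "n' x"] nd by simp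
    then have "((\<lambda>s. n (x + s *\<^sub>R a)) has_vector_derivative n' x a) (at 0)"
      using linear_scale[OF has_derivative_linear[OF nd]] by (simp add: has_vector_derivative_def)
    then show ?thesis using vector_derivative_unique_at that by blast
  qed
  show "n' x (t1 x) = \<kappa>1 x *\<^sub>R t1 x" "n' x (t2 x) = \<kappa>2 x *\<^sub>R t2 x"
    using frame[OF x] * unfolding principal_frame_def by blast+
qed

lemma tangent_expansion:
  assumes "x \<in> \<Gamma>" "h \<bullet> n x = 0"
  shows "h = (h \<bullet> t1 x) *\<^sub>R t1 x + (h \<bullet> t2 x) *\<^sub>R t2 x"
  using orthonormal_expansion_3[OF frame_orthonormal[OF assms(1)], of h] assms(2) by simp

lemma normal_derivative_surface:
  assumes x: "x \<in> \<Gamma>" and h: "h \<bullet> n x = 0"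
  shows "n' x h = (\<kappa>1 x * (h \<bullet> t1 x)) *\<^sub>R t1 x + (\<kappa>2 x * (h \<bullet> t2 x)) *\<^sub>R t2 x"
proof -
  have lin: "linear (n' x)"
    using has_derivative_linear[OF normal_has_derivative] x surface_subset_W by blast
  have "n' x h = n' x ((h \<bullet> t1 x) *\<^sub>R t1 x + (h \<bullet> t2 x) *\<^sub>R t2 x)"
    using tangent_expansion[OF assms] by simp
  then show ?thesis
    by (simp add: linear_add[OF lin] linear_scale[OF lin] frame_derivative[OF x] mult.commute)
qed

lemma curvature_factor_pos:
  assumes "x \<in> \<Gamma>" "\<bar>s\<bar> \<le> \<epsilon>"
  shows "1 + s * \<kappa>1 x \<ge> 1 - \<epsilon> * \<kappa>_max" "1 + s * \<kappa>2 x \<ge> 1 - \<epsilon> * \<kappa>_max"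
    "1 + s * \<kappa>1 x > 0" "1 + s * \<kappa>2 x > 0"
proof -
  have "\<bar>s * \<kappa>1 x\<bar> \<le> \<epsilon> * \<kappa>_max" "\<bar>s * \<kappa>2 x\<bar> \<le> \<epsilon> * \<kappa>_max"
    using curvature_bound[OF assms(1)] assms(2) unfolding abs_mult by (auto intro!: mult_mono)
  then show "1 + s * \<kappa>1 x \<ge> 1 - \<epsilon> * \<kappa>_max" "1 + s * \<kappa>2 x \<ge> 1 - \<epsilon> * \<kappa>_max"
    "1 + s * \<kappa>1 x > 0" "1 + s * \<kappa>2 x > 0" using \<epsilon>_small by linarith+
qed

lemma nearest_unique:
  assumes "z \<in> closure T" "nearest z y" shows "y = P z"
  using proj_well_defined assms nearest_proj[of z]
  unfolding proj_well_defined_on_def nearest_def by blast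

text \<open>The injectivity needed for the local inverse holds because on tangent vectors the map h
  + d(z0) N0 h is diagonal in the principal frame, with entries 1 + d(z0) \<kappa>_i that are
  positive by \<epsilon> \<kappa>_max < 1.\<close>

lemma tube_chart:
  assumes z0: "z0 \<in> closure T" and ch: "chart U \<phi> N" and x0: "P z0 \<in> U"
  obtains V e where "open V" "z0 \<in> V" "regular V" "e > 0"
    "\<And>s. \<bar>s - d z0\<bar> < e \<Longrightarrow> P (P z0 + s *\<^sub>R n (P z0)) = P z0 \<and> d (P z0 + s *\<^sub>R n (P z0)) = s"
proof -
  let ?x = "P z0"
  have xG: "?x \<in> \<Gamma>" by (rule proj_in_surface)
  obtain N0 where N0: "(N has_derivative N0) (at ?x)"
    using C1_on_differentiable[OF chartD(3)[OF ch] x0] unfolding differentiable_def by blast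
  have Nn: "N ?x = n ?x" using normal_eq_chart[OF ch x0 xG] by simp
  have inj: "h = 0 \<and> k = 0" if e: "h + d z0 *\<^sub>R N0 h + k *\<^sub>R N ?x = 0" and h: "h \<bullet> N ?x = 0" for h k
  proof -
    note o = frame_orthonormal[OF xG]
    have hn: "h \<bullet> n ?x = 0" using h Nn by simp
    have N0h: "N0 h = (\<kappa>1 ?x * (h \<bullet> t1 ?x)) *\<^sub>R t1 ?x + (\<kappa>2 ?x * (h \<bullet> t2 ?x)) *\<^sub>R t2 ?x"
      using tangent_chart_derivative[OF ch x0 xG N0 hn] normal_derivative_surface[OF xG hn] by simp
    have pos: "1 + d z0 * \<kappa>1 ?x > 0" "1 + d z0 * \<kappa>2 ?x > 0"
      using curvature_factor_pos[OF xG closure_tube_le[OF z0]] by auto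
    have "(1 + d z0 * \<kappa>1 ?x) * (h \<bullet> t1 ?x) = 0"
      using arg_cong[OF e, of "\<lambda>v. v \<bullet> t1 ?x"] o
      by (simp add: inner_add_left N0h Nn norm_eq_1 inner_commute algebra_simps)
    then have 1: "h \<bullet> t1 ?x = 0" using pos by simp
    have "(1 + d z0 * \<kappa>2 ?x) * (h \<bullet> t2 ?x) = 0"
      using arg_cong[OF e, of "\<lambda>v. v \<bullet> t2 ?x"] o
      by (simp add: inner_add_left N0h Nn norm_eq_1 inner_commute algebra_simps)
    then have 2: "h \<bullet> t2 ?x = 0" using pos by simp
    have h0: "h = 0" using tangent_expansion[OF xG hn] 1 2 by simp
    have "N0 h = 0" using N0h 1 2 by simp
    then have "k *\<^sub>R n ?x = 0" using e by (simp only: Nn) (simp add: h0)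
    then show ?thesis using h0 o(3) by auto
  qed
  show thesis
  proof (rule proj_C1_at_unique_nearest[OF ch x0 nearest_proj nearest_unique[OF z0] N0 inj])
    fix V e
    assume V: "open V" "z0 \<in> V" "C1_on P V" "C1_on d V" "P ` V \<subseteq> U" "e > 0"
      and e: "\<And>s. \<bar>s - d z0\<bar> < e \<Longrightarrow> P (?x + s *\<^sub>R N ?x) = ?x \<and> d (?x + s *\<^sub>R N ?x) = s"
    show thesis
      by (rule that[OF V(1,2) regularI[OF ch V(1,3-5)] V(6) e[unfolded Nn]])
  qed
qed

lemma closure_tube_subset_W: "closure T \<subseteq> W"
proof
  fix z assume z: "z \<in> closure T"
  obtain U \<phi> N where "chart U \<phi> N" "P z \<in> U" using chart_exists[OF proj_in_surface] .
  then show "z \<in> W" using tube_chart[OF z] unfolding W_def by blast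
qed

lemma tube_subset_W: "T \<subseteq> W"
  using closure_tube_subset_W closure_subset by blast

text \<open>Uniqueness of closest points does not say directly that the foot of a normal segment is
  closest to all its points. Connectedness of (-\<epsilon>, \<epsilon>) does: the set of s with d(x
  + s n(x)) = s contains 0, is closed by continuity of d, and is open by the local inverse.\<close>

lemma normal_line_in_tube:
  assumes x: "x \<in> \<Gamma>" and s: "\<bar>s\<bar> < \<epsilon>"
  shows "P (x + s *\<^sub>R n x) = x" "d (x + s *\<^sub>R n x) = s"
proof -
  let ?l = "\<lambda>s. x + s *\<^sub>R n x"
  let ?I = "{-\<epsilon><..<\<epsilon>}"
  define C where "C = {s \<in> ?I. d (?l s) = s}"
  \<comment> \<open>If d takes the value s there, then |s| is both the distance to \<Gamma> and the
    distance to x, so x is a closest point.\<close>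
  have near: "?l s \<in> T" "P (?l s) = x" if "s \<in> C" for s
  proof -
    have ds: "d (?l s) = s" "\<bar>s\<bar> < \<epsilon>" using that by (auto simp: C_def)
    then show T: "?l s \<in> T" by (simp add: tube_def)
    have "infdist (?l s) \<Gamma> = dist (?l s) x"
      using abs_signed_dist[of "?l s"] ds frame_orthonormal[OF x] by (simp add: dist_norm)
    then have "nearest (?l s) x" using x unfolding nearest_def by (metis infdist_le)
    then show "P (?l s) = x" using nearest_unique[OF subsetD[OF closure_subset T]] by simp
  qed
  have "closed {s. d (?l s) = s}"
    by (intro closed_Collect_eq continuous_intros
        continuous_on_compose2[OF continuous_signed_dist]) auto
  then have "closedin (top_of_set ?I) (?I \<inter> {s. d (?l s) = s})" by (rule closedin_closed_Int)
  moreover have "?I \<inter> {s. d (?l s) = s} = C" by (auto simp: C_def)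
  ultimately have cl: "closedin (top_of_set ?I) C" by simp
  have "open C"
    unfolding open_contains_ball
  proof
    fix s assume sC: "s \<in> C"
    have P: "P (?l s) = x" and T: "?l s \<in> closure T" and ds: "d (?l s) = s" and sI: "s \<in> ?I"
      using near[OF sC] subsetD[OF closure_subset near(1)[OF sC]] sC by (auto simp: C_def)
    obtain U \<phi> N where ch: "chart U \<phi> N" "P (?l s) \<in> U" using chart_exists[OF proj_in_surface] .
    obtain V e where e: "e > 0" "\<And>t. \<bar>t - s\<bar> < e \<Longrightarrow> d (?l t) = t"
      by (rule tube_chart[OF T ch]) (use P ds in metis)
    obtain e' where e': "e' > 0" "ball s e' \<subseteq> ?I" using openE[OF open_greaterThanLessThan sI] .
    have "ball s (min e e') \<subseteq> C"
      using e e' by (auto simp: C_def dist_real_def abs_minus_commute subset_iff)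
    then show "\<exists>e>0. ball s e \<subseteq> C" using e e' by (intro exI[of _ "min e e'"]) auto
  qed
  moreover have "C \<subseteq> ?I" by (auto simp: C_def)
  ultimately have op: "openin (top_of_set ?I) C" by (intro open_subset)
  have "0 \<in> C" using x \<epsilon>_pos by (simp add: C_def)
  moreover have "connected ?I" by (simp add: convex_connected)
  ultimately have "C = ?I" using op cl unfolding connected_clopen by blast
  then have "s \<in> C" using s by auto
  then show "P (?l s) = x" "d (?l s) = s" using near by (auto simp: C_def)
qed

lemma frame_at:
  assumes "z \<in> W"
  shows "norm (t1 (P z)) = 1" "norm (t2 (P z)) = 1" "norm (n z) = 1"
    "t1 (P z) \<bullet> t2 (P z) = 0" "t1 (P z) \<bullet> n z = 0" "t2 (P z) \<bullet> n z = 0"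
  using frame_orthonormal[OF proj_in_surface, of z] normal_proj[OF assms] by auto

lemma sing_val_pos:
  assumes "z \<in> closure T" shows "\<sigma>1 z > 0" "\<sigma>2 z > 0"
  using curvature_factor_pos[OF proj_in_surface closure_tube_le[OF assms]]
  by (auto simp: sing_val_def)

lemma sing_val_le:
  assumes "z \<in> closure T" shows "\<sigma>1 z \<le> inverse (1 - \<epsilon> * \<kappa>_max)" "\<sigma>2 z \<le> inverse (1 - \<epsilon> * \<kappa>_max)"
  using curvature_factor_pos[OF proj_in_surface closure_tube_le[OF assms], of z] \<epsilon>_small
  unfolding sing_val_def by (auto intro!: le_imp_inverse_le)

text \<open>Pairing \<open>proj_derivative_identity\<close> with the principal directions shows that
  the component of h along t_i is 1 + d \<kappa>_i times that of P' z h; the reciprocal factor is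
  \<sigma>_i.\<close>

lemma proj_derivative:
  assumes z: "z \<in> closure T"
  shows "P' z h = (\<sigma>1 z * (h \<bullet> t1 (P z))) *\<^sub>R t1 (P z) + (\<sigma>2 z * (h \<bullet> t2 (P z))) *\<^sub>R t2 (P z)"
    "n' z h = (\<kappa>1 (P z) * \<sigma>1 z * (h \<bullet> t1 (P z))) *\<^sub>R t1 (P z)
            + (\<kappa>2 (P z) * \<sigma>2 z * (h \<bullet> t2 (P z))) *\<^sub>R t2 (P z)"
proof -
  let ?a = "t1 (P z)" let ?b = "t2 (P z)" let ?k = "\<kappa>1 (P z)" let ?l = "\<kappa>2 (P z)"
  have zW: "z \<in> W" using z closure_tube_subset_W by blast
  note o = frame_at[OF zW]
  let ?p = "P' z h"
  have pt: "?p \<bullet> n (P z) = 0" using proj_derivative_tangent[OF zW] normal_proj[OF zW] by simp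
  have n'h: "n' z h = (?k * (?p \<bullet> ?a)) *\<^sub>R ?a + (?l * (?p \<bullet> ?b)) *\<^sub>R ?b"
    using normal_derivative_proj[OF zW] normal_derivative_surface[OF proj_in_surface pt] by simp
  have id: "h = ?p + d z *\<^sub>R n' z h + (h \<bullet> n z) *\<^sub>R n z" by (rule proj_derivative_identity[OF zW])
  have "h \<bullet> ?a = (1 + d z * ?k) * (?p \<bullet> ?a)"
    using arg_cong[OF id, of "\<lambda>v. v \<bullet> ?a"] o
    by (simp add: inner_add_left n'h norm_eq_1 inner_commute algebra_simps)
  then have a: "?p \<bullet> ?a = \<sigma>1 z * (h \<bullet> ?a)"
    using curvature_factor_pos[OF proj_in_surface closure_tube_le[OF z], of z]
    by (simp add: sing_val_def)
  have "h \<bullet> ?b = (1 + d z * ?l) * (?p \<bullet> ?b)"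
    using arg_cong[OF id, of "\<lambda>v. v \<bullet> ?b"] o
    by (simp add: inner_add_left n'h norm_eq_1 inner_commute algebra_simps)
  then have b: "?p \<bullet> ?b = \<sigma>2 z * (h \<bullet> ?b)"
    using curvature_factor_pos[OF proj_in_surface closure_tube_le[OF z], of z]
    by (simp add: sing_val_def)
  show "P' z h = (\<sigma>1 z * (h \<bullet> ?a)) *\<^sub>R ?a + (\<sigma>2 z * (h \<bullet> ?b)) *\<^sub>R ?b"
    using tangent_expansion[OF proj_in_surface pt] by (simp only: a b)
  show "n' z h = (?k * \<sigma>1 z * (h \<bullet> ?a)) *\<^sub>R ?a + (?l * \<sigma>2 z * (h \<bullet> ?b)) *\<^sub>R ?b"
    using n'h by (simp only: a b mult.assoc)
qed

end

section \<open>Surface differential operators\<close>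

lemma C1_on_frechet_derivative:
  assumes "C1_on f U" "x \<in> U"
  shows "(f has_derivative frechet_derivative f (at x)) (at x)"
  using C1_on_differentiable[OF assms] frechet_derivative_works by blast

lemma continuous_on_frechet_derivative:
  assumes "C1_on f U" "continuous_on S g" "g ` S \<subseteq> U" "continuous_on S v"
  shows "continuous_on S (\<lambda>x. frechet_derivative f (at (g x)) (v x))"
proof -
  obtain f' where f': "\<And>x. x \<in> U \<Longrightarrow> (f has_derivative blinfun_apply (f' x)) (at x)"
      "continuous_on U f'" using assms(1) unfolding C1_on_def by blast
  have c: "continuous_on S (\<lambda>x. f' (g x))"
    by (rule continuous_on_compose2[OF f'(2) assms(2,3)])
  have "continuous_on S (\<lambda>x. blinfun_apply (f' (g x)) (v x))"
    by (rule bounded_bilinear.continuous_on[OF bounded_bilinear_blinfun_apply c assms(4)])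
  then show ?thesis
  proof (rule continuous_on_eq)
    fix x assume "x \<in> S"
    then have "g x \<in> U" using assms(3) by blast
    then show "blinfun_apply (f' (g x)) (v x) = frechet_derivative f (at (g x)) (v x)"
      using frechet_derivative_at[OF f'(1)] by metis
  qed
qed

lemma Ck_onE:
  assumes "Ck_on k f S" "x \<in> S"
  obtains U F where "open U" "x \<in> U" "Ck_open k F U" "\<And>y. y \<in> U \<Longrightarrow> y \<in> S \<Longrightarrow> F y = f y"
  using bspec[OF assms(1)[unfolded Ck_on_def] assms(2)] by (elim exE conjE) auto

lemma tensor_mult_vec: "tensor a b *v x = (b \<bullet> x) *\<^sub>R a"
  by (simp add: vec_eq_iff tensor_def matrix_vector_mult_def inner_vec_def sum_distrib_left mult_ac)

definition divergence :: "(real^3 \<Rightarrow> real^3) \<Rightarrow> real^3 \<Rightarrow> real" where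
  "divergence Y z = (\<Sum>i\<in>UNIV. frechet_derivative Y (at z) (axis i 1) $ i)"

lemma continuous_on_divergence:
  assumes "C1_on Y U" "continuous_on S g" "g ` S \<subseteq> U"
  shows "continuous_on S (\<lambda>x. divergence Y (g x))"
  unfolding divergence_def
  by (intro continuous_on_sum continuous_on_component continuous_on_frechet_derivative[OF assms]
      continuous_on_const)

context C2_domain
begin

lemma proj_proj [simp]: "P (P z) = P z"
  by (simp add: proj_in_surface)

text \<open>On \<Gamma> the derivative of P is the orthogonal projection onto the tangent plane, so
  u o P has a tangential gradient there. Conversely, P maps into \<Gamma>, so any derivative of u
  within \<Gamma> yields one of u o P; this gives uniqueness in the definition of the surface
  gradient. Surface operators thereby become Euclidean ones.\<close>

lemma
  assumes x: "x \<in> \<Gamma>" and diff: "(\<lambda>z. u (P z)) differentiable at x"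
  shows surf_grad_eq_gradient: "surf_grad \<Omega> u x = gradient (\<lambda>z. u (P z)) x"
    and gradient_comp_proj_tangent: "gradient (\<lambda>z. u (P z)) x \<bullet> n x = 0"
proof -
  have xW: "x \<in> W" using x surface_subset_W by blast
  let ?w = "\<lambda>z. u (P z)" and ?g = "gradient (\<lambda>z. u (P z)) x"
  have g: "(?w has_derivative (\<lambda>h. h \<bullet> ?g)) (at x)"
    using GDERIV_gradient[OF diff] by (simp add: gderiv_def)
  have P'x: "(P has_derivative P' x) (at x)" by (rule proj_has_derivative[OF xW])
  have "(?w has_derivative (\<lambda>h. h \<bullet> ?g)) (at (P x))" using g x by simp
  from has_derivative_compose[OF P'x this]
  have "(?w has_derivative (\<lambda>h. P' x h \<bullet> ?g)) (at x)" by simp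
  from fun_cong[OF has_derivative_unique[OF this g], of "n x"]
  show tang: "?g \<bullet> n x = 0"
    using norm_normal[OF xW] by (simp add: proj_derivative_surface[OF x] norm_eq_1 inner_commute)
  show "surf_grad \<Omega> u x = ?g"
    unfolding surf_grad_def
  proof (rule the_equality, intro conjI tang)
    show "(u has_derivative (\<lambda>h. h \<bullet> ?g)) (at x within \<Gamma>)"
      by (rule has_derivative_transform[OF x _ has_derivative_at_withinI[OF g]]) simp
    fix q assume q: "q \<bullet> n x = 0 \<and> (u has_derivative (\<lambda>h. h \<bullet> q)) (at x within \<Gamma>)"
    have "(u has_derivative (\<lambda>h. h \<bullet> q)) (at (P x) within range P)"
      using q x proj_in_surface by (auto intro: has_derivative_subset)
    from has_derivative_in_compose[OF P'x this]
    have "(?w has_derivative (\<lambda>h. P' x h \<bullet> q)) (at x)" .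
    from has_derivative_unique[OF this g]
    have "h \<bullet> ?g = P' x h \<bullet> q" for h by metis
    moreover have "P' x h \<bullet> q = h \<bullet> q" for h
      using q by (simp add: proj_derivative_surface[OF x] inner_diff_left inner_diff_right inner_commute)
    ultimately show "q = ?g" by (metis vector_eq_ldot)
  qed
qed

lemma surf_div_eq_divergence:
  assumes x: "x \<in> \<Gamma>" and diff: "(\<lambda>z. X (P z)) differentiable at x"
  shows "surf_div \<Omega> X x = divergence (\<lambda>z. X (P z)) x"
  unfolding surf_div_def divergence_def
proof (rule sum.cong[OF refl])
  fix i :: 3
  let ?Y = "\<lambda>z. X (P z)"
  have Y: "(?Y has_derivative frechet_derivative ?Y (at x)) (at x)"
    using diff frechet_derivative_works by blast
  then have d: "((\<lambda>z. ?Y z $ i) has_derivative (\<lambda>h. frechet_derivative ?Y (at x) h $ i)) (at x)"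
    by (rule bounded_linear.has_derivative[OF bounded_linear_vec_nth])
  then have diff': "(\<lambda>z. ?Y z $ i) differentiable at x" unfolding differentiable_def by blast
  have "((\<lambda>z. ?Y z $ i) has_derivative (\<lambda>h. h \<bullet> gradient (\<lambda>z. ?Y z $ i) x)) (at x)"
    using GDERIV_gradient[OF diff'] by (simp add: gderiv_def)
  from fun_cong[OF has_derivative_unique[OF d this], of "axis i 1"]
  show "surf_grad \<Omega> (\<lambda>y. X y $ i) x $ i = frechet_derivative ?Y (at x) (axis i 1) $ i"
    using surf_grad_eq_gradient[OF x diff'] by (simp add: inner_axis')
qed

text \<open>From u o P being C^1 its gradient would only be continuous. The surface gradient at P y
  is instead the tangential part of the gradient of a local C^2 extension F, evaluated at P y, and a
  composition of C^1 maps.\<close>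

lemma
  assumes u: "Ck_on 2 u \<Gamma>"
  shows comp_proj_C1: "C1_on (\<lambda>z. u (P z)) W"
    and surf_grad_comp_proj_C1: "C1_on (\<lambda>z. surf_grad \<Omega> u (P z)) W"
proof -
  have loc: "\<exists>V F G. open V \<and> z \<in> V \<and> V \<subseteq> W \<and> C1_on F V \<and> C1_on G V \<and>
      (\<forall>y\<in>V. F y = u (P y) \<and> G y = surf_grad \<Omega> u (P y))" if z: "z \<in> W" for z
  proof -
    obtain U F where U: "open U" "P z \<in> U" "Ck_open 2 F U" "\<And>y. y \<in> U \<Longrightarrow> y \<in> \<Gamma> \<Longrightarrow> F y = u y"
      using Ck_onE[OF u proj_in_surface[of z]] by metis
    note F = Ck_open_2D[OF U(3,1)]
    define V where "V = W \<inter> P -` U"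
    have V: "open V"
      unfolding V_def
      using C1_on_imp_continuous_on[OF proj_C1] open_W U(1) by (simp add: continuous_on_open_vimage Int_commute)
    have PV: "P ` V \<subseteq> U" "P ` V \<subseteq> W" "V \<subseteq> W" using proj_in_W by (auto simp: V_def)
    have FP: "C1_on (\<lambda>y. F (P y)) V"
      by (rule C1_on_compose[OF C1_on_subset[OF proj_C1 PV(3)] F(2) PV(1)])
    define G where "G y = gradient F y - (gradient F y \<bullet> n y) *\<^sub>R n y" for y
    have "C1_on G (U \<inter> W)"
      unfolding G_def
      by (intro C1_on_diff C1_on_scaleR C1_on_inner C1_on_subset[OF F(1)] C1_on_subset[OF normal_C1]) auto
    then have GP: "C1_on (\<lambda>y. G (P y)) V"
      using C1_on_compose[OF C1_on_subset[OF proj_C1 PV(3)], of G "U \<inter> W"] PV by auto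
    have "surf_grad \<Omega> u (P y) = G (P y)" if y: "y \<in> V" for y
    proof -
      let ?x = "P y"
      have x: "?x \<in> \<Gamma>" "?x \<in> W" "?x \<in> U" "?x \<in> V"
        using y proj_in_surface proj_in_W PV(1) by (auto simp: V_def)
      have "(F has_derivative (\<lambda>h. h \<bullet> gradient F ?x)) (at (P ?x))"
        using F(3)[OF x(3)] by (simp add: gderiv_def)
      from has_derivative_compose[OF proj_has_derivative[OF x(2)] this]
      have "((\<lambda>z. F (P z)) has_derivative (\<lambda>h. P' ?x h \<bullet> gradient F ?x)) (at ?x)" .
      moreover have "P' ?x h \<bullet> gradient F ?x = h \<bullet> G ?x" for h
        by (simp add: proj_derivative_surface[OF x(1)] G_def inner_diff_left inner_diff_right inner_commute)
      ultimately have "((\<lambda>z. F (P z)) has_derivative (\<lambda>h. h \<bullet> G ?x)) (at ?x)" by simp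
      then have d: "((\<lambda>z. u (P z)) has_derivative (\<lambda>h. h \<bullet> G ?x)) (at ?x)"
        by (rule has_derivative_transform_within_open[OF _ V x(4)])
          (use U(4) PV(1) proj_in_surface in blast)
      then have "gradient (\<lambda>z. u (P z)) ?x = G ?x" by (simp add: gradient_eqI gderiv_def)
      then show ?thesis using surf_grad_eq_gradient[OF x(1)] d differentiable_def by metis
    qed
    moreover have "F (P y) = u (P y)" if "y \<in> V" for y
      using U(4) PV(1) that proj_in_surface by blast
    moreover have "z \<in> V" using z U(2) by (simp add: V_def)
    ultimately show ?thesis
      using V FP GP PV(3) by (intro exI[of _ V] exI[of _ "\<lambda>y. F (P y)"] exI[of _ "\<lambda>y. G (P y)"]) auto
  qed
  show "C1_on (\<lambda>z. u (P z)) W" "C1_on (\<lambda>z. surf_grad \<Omega> u (P z)) W"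
    by (rule C1_on_local, drule loc, blast)+
qed

text \<open>The regularity of L is expressed by local extensions \<Lambda>. For x on \<Gamma> an
  extension agrees with L for all p near the given one, so the p-part of its gradient is L_p
  whichever extension is taken.\<close>

lemma L_p_comp_proj_C1:
  assumes L: "Ck_on 2 (\<lambda>(x, q, p). L x q p) (\<Gamma> \<times> UNIV \<times> UNIV)"
    and u: "C1_on (\<lambda>z. u (P z)) W" and p: "C1_on (\<lambda>z. p (P z)) W"
  shows "C1_on (\<lambda>z. L_p L (P z) (u (P z)) (p (P z))) W"
proof (rule C1_on_local)
  fix z assume z: "z \<in> W"
  define m where "m z = (P z, u (P z), p (P z))" for z
  have mC: "C1_on m W" unfolding m_def by (intro C1_on_Pair proj_C1 u p)
  have "m z \<in> \<Gamma> \<times> UNIV \<times> UNIV" by (simp add: m_def proj_in_surface)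
  from Ck_onE[OF L this] obtain U \<Lambda> where U: "open U" "m z \<in> U" "Ck_open 2 \<Lambda> U"
      "\<And>y. y \<in> U \<Longrightarrow> y \<in> \<Gamma> \<times> UNIV \<times> UNIV \<Longrightarrow> \<Lambda> y = (\<lambda>(x, q, p). L x q p) y"
    by metis
  note \<Lambda> = Ck_open_2D[OF U(3,1)]
  define V where "V = W \<inter> m -` U"
  have V: "open V"
    unfolding V_def
    using C1_on_imp_continuous_on[OF mC] open_W U(1) by (simp add: continuous_on_open_vimage Int_commute)
  have "C1_on (\<lambda>y. gradient \<Lambda> (m y)) V"
    by (rule C1_on_compose[OF C1_on_subset[OF mC] \<Lambda>(1)]) (auto simp: V_def)
  then have C: "C1_on (\<lambda>y. snd (snd (gradient \<Lambda> (m y)))) V" by (intro C1_on_snd)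
  have "snd (snd (gradient \<Lambda> (m y))) = L_p L (P y) (u (P y)) (p (P y))" if y: "y \<in> V" for y
  proof -
    let ?e = "\<lambda>r. (P y, u (P y), r)" and ?p = "p (P y)"
    have eU: "?e ?p \<in> U" using y by (simp add: V_def m_def)
    have op: "open (?e -` U)" using U(1) by (intro open_vimage continuous_intros)
    have "(?e has_derivative (\<lambda>h. (0, 0, h))) (at ?p)"
      by (intro has_derivative_Pair has_derivative_const has_derivative_ident)
    moreover have "(\<Lambda> has_derivative (\<lambda>h. h \<bullet> gradient \<Lambda> (m y))) (at (?e ?p))"
      using \<Lambda>(3)[OF eU] by (simp add: gderiv_def m_def)
    ultimately have "((\<lambda>r. \<Lambda> (?e r)) has_derivative (\<lambda>h. (0, 0, h) \<bullet> gradient \<Lambda> (m y))) (at ?p)"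
      by (rule has_derivative_compose)
    then have "((\<lambda>r. \<Lambda> (?e r)) has_derivative (\<lambda>h. h \<bullet> snd (snd (gradient \<Lambda> (m y))))) (at ?p)"
      by (simp add: inner_prod_def)
    then have "((\<lambda>r. L (P y) (u (P y)) r) has_derivative (\<lambda>h. h \<bullet> snd (snd (gradient \<Lambda> (m y))))) (at ?p)"
      by (rule has_derivative_transform_within_open[OF _ op])
        (use eU U(4) proj_in_surface in auto)
    then show ?thesis unfolding L_p_def by (simp add: gradient_eqI gderiv_def)
  qed
  then show "\<exists>V g. open V \<and> z \<in> V \<and> C1_on g V \<and> (\<forall>y\<in>V. g y = L_p L (P y) (u (P y)) (p (P y)))"
    using V C z U(2) by (intro exI[of _ V] exI[of _ "\<lambda>y. snd (snd (gradient \<Lambda> (m y)))"]) (auto simp: V_def)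
qed

end

section \<open>The matrix A and the factor J on the closed tube\<close>

context tubular_neighbourhood
begin

lemma Amat_mult_vec:
  "Amat \<Omega> t1 t2 \<kappa>1 \<kappa>2 \<mu> z *v x =
     (inverse (\<sigma>1 z) * (x \<bullet> t1 (P z))) *\<^sub>R t1 (P z) + (inverse (\<sigma>2 z) * (x \<bullet> t2 (P z))) *\<^sub>R t2 (P z)
     + (\<mu> * (x \<bullet> n z)) *\<^sub>R n z"
  by (simp add: Amat_def matrix_vector_mult_add_rdistrib scaleR_matrix_vector_assoc[symmetric]
      tensor_mult_vec inner_commute)

text \<open>By the chain rule the gradient of u o P at z has no normal component, and its components
  along t_i are those of the surface gradient times \<sigma>_i. The entries 1/\<sigma>_i of A undo
  these factors.\<close>

lemma gradient_comp_proj: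
  assumes z: "z \<in> closure T" and u: "C1_on (\<lambda>z. u (P z)) W"
  shows "((\<lambda>z. u (P z)) has_derivative (\<lambda>h. P' z h \<bullet> surf_grad \<Omega> u (P z))) (at z)"
    and "Amat \<Omega> t1 t2 \<kappa>1 \<kappa>2 \<mu> z *v gradient (\<lambda>z. u (P z)) z = surf_grad \<Omega> u (P z)"
proof -
  let ?w = "\<lambda>z. u (P z)" and ?p = "surf_grad \<Omega> u (P z)" and ?a = "t1 (P z)" and ?b = "t2 (P z)"
  have zW: "z \<in> W" using z closure_tube_subset_W by blast
  note o = frame_at[OF zW]
  have diff: "?w differentiable at (P z)" using C1_on_differentiable[OF u proj_in_W] .
  have p: "?p = gradient ?w (P z)" by (rule surf_grad_eq_gradient[OF proj_in_surface diff])
  have "(?w has_derivative (\<lambda>h. h \<bullet> ?p)) (at (P z))"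
    using GDERIV_gradient[OF diff] by (simp add: p gderiv_def)
  from has_derivative_compose[OF proj_has_derivative[OF zW] this]
  show der: "(?w has_derivative (\<lambda>h. P' z h \<bullet> ?p)) (at z)" by simp
  have tang: "?p \<bullet> n z = 0"
    using gradient_comp_proj_tangent[OF proj_in_surface diff] normal_proj[OF zW] p by simp
  define g where "g = (\<sigma>1 z * (?p \<bullet> ?a)) *\<^sub>R ?a + (\<sigma>2 z * (?p \<bullet> ?b)) *\<^sub>R ?b"
  have "P' z h \<bullet> ?p = h \<bullet> g" for h
    by (simp add: proj_derivative[OF z] g_def inner_add_left inner_add_right inner_commute)
  then have "gradient ?w z = g" using der by (simp add: gradient_eqI gderiv_def)
  moreover have "g \<bullet> ?a = \<sigma>1 z * (?p \<bullet> ?a)" "g \<bullet> ?b = \<sigma>2 z * (?p \<bullet> ?b)" "g \<bullet> n z = 0"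
    using o by (simp_all add: g_def inner_add_left inner_add_right norm_eq_1 inner_commute)
  ultimately show "Amat \<Omega> t1 t2 \<kappa>1 \<kappa>2 \<mu> z *v gradient ?w z = ?p"
    using sing_val_pos[OF z] tangent_expansion[OF proj_in_surface, of ?p z] tang normal_proj[OF zW]
    by (simp add: Amat_mult_vec mult.assoc[symmetric])
qed

text \<open>The determinant mentions neither frame nor curvatures, so continuity of J reduces to
  that of P' and n.\<close>

lemma Jac_eq_det:
  assumes z: "z \<in> closure T"
  shows "Jac \<Omega> \<kappa>1 \<kappa>2 z = det (matrix (\<lambda>h. P' z h + (h \<bullet> n z) *\<^sub>R n z))"
  using det_orthonormal_eigenbasis_3[OF frame_at, of z "\<sigma>1 z" "\<sigma>2 z" 1] closure_tube_subset_W z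
  by (auto simp: Jac_def proj_derivative[OF z])

lemma continuous_on_Jac: "continuous_on (closure T) (Jac \<Omega> \<kappa>1 \<kappa>2)"
proof -
  have c: "continuous_on (closure T) (\<lambda>z. P' z h)" for h
    unfolding P'_def
    by (rule continuous_on_frechet_derivative[OF proj_C1]) (use closure_tube_subset_W in auto)
  have cn: "continuous_on (closure T) n"
    using C1_on_imp_continuous_on[OF normal_C1] closure_tube_subset_W continuous_on_subset by blast
  have "continuous_on (closure T) (\<lambda>z. det (matrix (\<lambda>h. P' z h + (h \<bullet> n z) *\<^sub>R n z)))"
    unfolding det_3 matrix_def by (simp, intro continuous_intros c cn)
  then show ?thesis by (rule continuous_on_eq) (simp add: Jac_eq_det)
qed

text \<open>On a tangent vector X the matrix A acts as X + d n'(P z) X, which is again free of the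
  frame.\<close>

lemma continuous_on_Jac_Amat:
  assumes X: "continuous_on (closure T) (\<lambda>z. X (P z))" "\<And>z. z \<in> closure T \<Longrightarrow> X (P z) \<bullet> n z = 0"
  shows "continuous_on (closure T) (\<lambda>z. Jac \<Omega> \<kappa>1 \<kappa>2 z *\<^sub>R (Amat \<Omega> t1 t2 \<kappa>1 \<kappa>2 \<mu> z *v X (P z)))"
proof -
  have cP: "continuous_on (closure T) P"
    using C1_on_imp_continuous_on[OF proj_C1] closure_tube_subset_W continuous_on_subset by blast
  have "continuous_on (closure T) (\<lambda>z. n' (P z) (X (P z)))"
    unfolding n'_def
    by (rule continuous_on_frechet_derivative[OF normal_C1 cP _ X(1)]) (use proj_in_W in auto)
  then have "continuous_on (closure T) (\<lambda>z. Jac \<Omega> \<kappa>1 \<kappa>2 z *\<^sub>R (X (P z) + d z *\<^sub>R n' (P z) (X (P z))))"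
    by (intro continuous_intros continuous_on_Jac X(1) continuous_on_signed_dist)
  then show ?thesis
  proof (rule continuous_on_eq)
    fix z assume z: "z \<in> closure T"
    let ?x = "P z" and ?X = "X (P z)"
    have Xn: "?X \<bullet> n ?x = 0" using X(2)[OF z] normal_proj closure_tube_subset_W z by auto
    have inv: "inverse (\<sigma>1 z) = 1 + d z * \<kappa>1 ?x" "inverse (\<sigma>2 z) = 1 + d z * \<kappa>2 ?x"
      by (simp_all add: sing_val_def)
    have "?X + d z *\<^sub>R n' ?x ?X = Amat \<Omega> t1 t2 \<kappa>1 \<kappa>2 \<mu> z *v ?X"
      unfolding Amat_mult_vec X(2)[OF z] inv normal_derivative_surface[OF proj_in_surface Xn]
      by (subst (1) tangent_expansion[OF proj_in_surface Xn]) (simp add: algebra_simps)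
    then show "Jac \<Omega> \<kappa>1 \<kappa>2 z *\<^sub>R (?X + d z *\<^sub>R n' ?x ?X) =
        Jac \<Omega> \<kappa>1 \<kappa>2 z *\<^sub>R (Amat \<Omega> t1 t2 \<kappa>1 \<kappa>2 \<mu> z *v ?X)" by simp
  qed
qed

end

section \<open>Squeezing the tube onto the surface\<close>

lemma has_integral_zero_change_of_variables:
  fixes f :: "real^3 \<Rightarrow> real" and g :: "real^3 \<Rightarrow> real^3"
  assumes f: "integrable lborel f" "(LINT x|lborel. f x) = 0" "\<And>y. y \<notin> g ` S \<Longrightarrow> f y = 0"
    and S: "open S" "inj_on g S" "\<And>x. x \<in> S \<Longrightarrow> (g has_derivative g' x) (at x)"
  shows "((\<lambda>x. \<bar>det (matrix (g' x))\<bar> * f (g x)) has_integral 0) S"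
proof -
  \<comment> \<open>The change of variables theorem is for vector-valued integrands, so f is carried
    in the first coordinate.\<close>
  define F :: "real^3 \<Rightarrow> real^3" where "F y = f y *\<^sub>R axis 1 1" for y
  have F: "integrable lborel F" unfolding F_def using f(1) by simp
  have "F y = (if y \<in> g ` S then F y else 0)" for y using f(3) by (simp add: F_def)
  then have eq: "(\<lambda>y. if y \<in> g ` S then F y else 0) = F" by presburger
  have "integrable lebesgue F" using F by (simp add: integrable_completion)
  then have "F absolutely_integrable_on UNIV" by (simp add: set_integrable_def)
  then have 1: "F absolutely_integrable_on g ` S"
    using absolutely_integrable_restrict_UNIV[of "g ` S" F] eq by simp
  have "(F has_integral (LINT x|lborel. F x)) UNIV" by (rule has_integral_integral_lborel[OF F])
  then have "(F has_integral 0) UNIV" using f(1,2) by (simp add: F_def)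
  then have int: "(F has_integral 0) (g ` S)" using has_integral_restrict_UNIV[of "g ` S" F] eq by simp
  have Sl: "S \<in> sets lebesgue" using S(1) by (simp add: borel_open sets_completionI_sets)
  from 1 int have "F absolutely_integrable_on g ` S \<and> integral (g ` S) F = 0"
    by (simp add: integral_unique)
  then have 2: "(\<lambda>x. \<bar>det (matrix (g' x))\<bar> *\<^sub>R F (g x)) absolutely_integrable_on S \<and>
      integral S (\<lambda>x. \<bar>det (matrix (g' x))\<bar> *\<^sub>R F (g x)) = 0"
    using has_absolute_integral_change_of_variables[OF Sl has_derivative_at_withinI[OF S(3)] S(2), of F 0]
    by simp
  from integrable_integral[OF set_lebesgue_integral_eq_integral(1)[OF conjunct1[OF 2]]]
  have "((\<lambda>x. \<bar>det (matrix (g' x))\<bar> *\<^sub>R F (g x)) has_integral 0) S"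
    unfolding conjunct2[OF 2] .
  from has_integral_linear[OF this bounded_linear_vec_nth[of 1]]
  show ?thesis by (simp add: o_def F_def)
qed

lemma divergence_transform_open:
  assumes "C1_on Y S" "open S" "y \<in> S" "\<And>x. x \<in> S \<Longrightarrow> Z x = Y x"
  shows "divergence Z y = divergence Y y"
proof -
  have "(Z has_derivative frechet_derivative Y (at y)) (at y)"
    by (rule has_derivative_transform_within_open[OF C1_on_frechet_derivative[OF assms(1,3)] assms(2,3)])
      (simp add: assms(4))
  from frechet_derivative_at[OF this, symmetric] show ?thesis by (simp add: divergence_def)
qed

lemma divergence_scaleR:
  assumes f: "(f has_derivative f') (at y)" and Y: "Y differentiable at y"
  shows "divergence (\<lambda>x. f x *\<^sub>R Y x) y = f' (Y y) + f y * divergence Y y"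
proof -
  have Y': "(Y has_derivative frechet_derivative Y (at y)) (at y)"
    using Y frechet_derivative_works by blast
  have "((\<lambda>x. f x *\<^sub>R Y x) has_derivative
      (\<lambda>h. f y *\<^sub>R frechet_derivative Y (at y) h + f' h *\<^sub>R Y y)) (at y)"
    by (rule has_derivative_scaleR[OF f Y'])
  from frechet_derivative_at[OF this, symmetric]
  have e: "frechet_derivative (\<lambda>x. f x *\<^sub>R Y x) (at y) =
      (\<lambda>h. f y *\<^sub>R frechet_derivative Y (at y) h + f' h *\<^sub>R Y y)" .
  have lin: "linear f'" using f has_derivative_linear by blast
  have "Y y = (\<Sum>i\<in>UNIV. Y y $ i *\<^sub>R axis i 1)"
    using basis_expansion[of "Y y"] by (simp add: scalar_mult_eq_scaleR)
  from arg_cong[OF this, of f']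
  have "f' (Y y) = (\<Sum>i\<in>UNIV. Y y $ i * f' (axis i 1))"
    by (simp only: linear_sum[OF lin] linear_scale[OF lin] real_scaleR_def)
  then show ?thesis
    unfolding divergence_def e by (simp add: sum.distrib sum_distrib_left mult.commute)
qed

lemma integral_divergence_compact_support:
  assumes Z: "C1_on Z UNIV" and C: "compact C" "\<And>y. y \<notin> C \<Longrightarrow> Z y = 0"
  shows "integrable lborel (divergence Z)" "(LINT y|lborel. divergence Z y) = 0"
proof -
  have *: "integrable lborel (\<lambda>y. frechet_derivative Z (at y) v $ i) \<and>
      (LINT y|lborel. frechet_derivative Z (at y) v $ i) = 0" for v i
  proof -
    have "C1_on (\<lambda>y. Z y $ i) UNIV"
      by (rule C1_on_linear_compose[OF Z bounded_linear_vec_nth])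
    then obtain f' where f': "\<And>y. ((\<lambda>y. Z y $ i) has_derivative blinfun_apply (f' y)) (at y)"
        "continuous_on UNIV f'" unfolding C1_on_def by blast
    have "((\<lambda>y. Z y $ i) has_derivative (\<lambda>h. frechet_derivative Z (at y) h $ i)) (at y)" for y
      by (rule bounded_linear.has_derivative[OF bounded_linear_vec_nth C1_on_frechet_derivative[OF Z UNIV_I]])
    note d = this
    have e: "(\<lambda>y. frechet_derivative Z (at y) v $ i) = (\<lambda>y. f' y v)"
      by (rule ext, rule fun_cong[OF has_derivative_unique[OF d f'(1)]])
    show ?thesis
      unfolding e using integral_derivative_compact_support[OF f' C(1), of v] C(2) by simp
  qed
  then show "integrable lborel (divergence Z)" "(LINT y|lborel. divergence Z y) = 0"
    unfolding divergence_def by auto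
qed

lemma divergence_eq_0:
  assumes "closed C" "\<And>y. y \<notin> C \<Longrightarrow> Z y = 0" "y \<notin> C"
  shows "divergence Z y = 0"
proof -
  have "divergence Z y = divergence (\<lambda>_. 0) y"
    by (rule divergence_transform_open[where S = "- C"]) (use assms in \<open>auto intro: C1_on_const\<close>)
  then show ?thesis by (simp add: divergence_def)
qed

context tubular_neighbourhood
begin

text \<open>The map \<Psi> of the overview, with s in place of \<tau>. It is used for s = \<tau>
  and, as its inverse on the smaller tube, for s = 1/\<tau>.\<close>

definition flow :: "real \<Rightarrow> real^3 \<Rightarrow> real^3" where
  "flow s z = P z + (s * d z) *\<^sub>R n (P z)"

lemma
  assumes "\<bar>s * d z\<bar> < \<epsilon>"
  shows proj_flow: "P (flow s z) = P z" and signed_dist_flow: "d (flow s z) = s * d z"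
    and flow_in_tube: "flow s z \<in> T"
  using normal_line_in_tube[OF proj_in_surface assms] assms by (auto simp: flow_def tube_def)

lemma flow_flow: "\<bar>s * d z\<bar> < \<epsilon> \<Longrightarrow> flow t (flow s z) = flow (t * s) z"
  unfolding flow_def[of t] flow_def[of "t * s"] by (simp add: proj_flow signed_dist_flow mult.assoc)

lemma flow_1 [simp]: "flow 1 z = z"
  using normal_line by (simp add: flow_def)

lemma flow_C1: "C1_on (flow s) W"
proof -
  have "C1_on (\<lambda>z. n (P z)) W" by (rule C1_on_transform[OF normal_C1 open_W normal_proj])
  then have "C1_on (\<lambda>z. P z + (s *\<^sub>R d z) *\<^sub>R n (P z)) W"
    by (intro C1_on_add C1_on_scaleR C1_on_const proj_C1 signed_dist_C1)
  then show ?thesis by (rule C1_on_transform[OF _ open_W]) (simp add: flow_def)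
qed

text \<open>This is (1 + s d \<kappa>) / (1 + d \<kappa>), the stretch in a principal direction from
  the parallel surface at signed distance d to the one at s d. For s = 0 it is \<sigma>, the value
  that appears in the limit.\<close>

definition flow_factor :: "(real^3 \<Rightarrow> real) \<Rightarrow> real \<Rightarrow> real^3 \<Rightarrow> real" where
  "flow_factor \<kappa> s z = sing_val \<Omega> \<kappa> z * (1 + s * d z * \<kappa> (P z))"

text \<open>Only P' and n' at z enter, so s may exceed 1, as it does for the inverse map.\<close>

lemma flow_has_derivative:
  assumes z: "z \<in> closure T"
  shows "(flow s has_derivative (\<lambda>h. (flow_factor \<kappa>1 s z * (h \<bullet> t1 (P z))) *\<^sub>R t1 (P z) +
      (flow_factor \<kappa>2 s z * (h \<bullet> t2 (P z))) *\<^sub>R t2 (P z) + (s * (h \<bullet> n z)) *\<^sub>R n z)) (at z)"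
proof -
  have zW: "z \<in> W" using z closure_tube_subset_W by blast
  have d': "(d has_derivative (\<lambda>h. h \<bullet> n z)) (at z)"
    using signed_dist_gderiv[OF zW] by (simp add: gderiv_def)
  have "((\<lambda>z. P z + (s * d z) *\<^sub>R n z) has_derivative
      (\<lambda>h. P' z h + ((s * d z) *\<^sub>R n' z h + (s * (h \<bullet> n z)) *\<^sub>R n z))) (at z)"
    by (intro has_derivative_add has_derivative_scaleR has_derivative_mult_right d'
        proj_has_derivative normal_has_derivative zW)
  then have "(flow s has_derivative
      (\<lambda>h. P' z h + ((s * d z) *\<^sub>R n' z h + (s * (h \<bullet> n z)) *\<^sub>R n z))) (at z)"
    by (rule has_derivative_transform_within_open[OF _ open_W zW]) (simp add: flow_def normal_proj)
  then show ?thesis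
    by (simp add: proj_derivative[OF z] flow_factor_def algebra_simps)
qed

lemma det_flow:
  assumes z: "z \<in> closure T"
  shows "det (matrix (\<lambda>h. (flow_factor \<kappa>1 s z * (h \<bullet> t1 (P z))) *\<^sub>R t1 (P z) +
      (flow_factor \<kappa>2 s z * (h \<bullet> t2 (P z))) *\<^sub>R t2 (P z) + (s * (h \<bullet> n z)) *\<^sub>R n z)) =
    flow_factor \<kappa>1 s z * flow_factor \<kappa>2 s z * s"
  using closure_tube_subset_W z by (intro det_orthonormal_eigenbasis_3 frame_at) auto

lemma flow_factor_pos:
  assumes "z \<in> T" "0 \<le> s" "s \<le> 1"
  shows "flow_factor \<kappa>1 s z > 0" "flow_factor \<kappa>2 s z > 0"
proof -
  have "z \<in> closure T" using assms(1) closure_subset by blast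
  moreover have "\<bar>s * d z\<bar> \<le> \<epsilon>"
    using assms mult_mono[of "\<bar>s\<bar>" 1 "\<bar>d z\<bar>" \<epsilon>] by (simp add: abs_mult tube_def)
  ultimately show "flow_factor \<kappa>1 s z > 0" "flow_factor \<kappa>2 s z > 0"
    using curvature_factor_pos[OF proj_in_surface, of "s * d z" z] sing_val_pos[of z]
    unfolding flow_factor_def by simp_all
qed

lemma flow_factor_inverse:
  assumes z: "z \<in> T" and s: "0 < s" "s \<le> 1"
  shows "flow_factor \<kappa>1 (1 / s) (flow s z) = inverse (flow_factor \<kappa>1 s z)"
    "flow_factor \<kappa>2 (1 / s) (flow s z) = inverse (flow_factor \<kappa>2 s z)"
proof -
  have sd: "\<bar>s * d z\<bar> < \<epsilon>"
    using z s mult_left_le_one_le[of "\<bar>d z\<bar>" s] by (simp add: abs_mult tube_def)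
  show "flow_factor \<kappa>1 (1 / s) (flow s z) = inverse (flow_factor \<kappa>1 s z)"
    "flow_factor \<kappa>2 (1 / s) (flow s z) = inverse (flow_factor \<kappa>2 s z)"
    using s(1) by (simp_all add: flow_factor_def sing_val_def proj_flow[OF sd] signed_dist_flow[OF sd] mult.commute)
qed

text \<open>The compactly supported field Z has a divergence of integral zero, which is pulled back
  by \<open>flow \<tau>\<close>. At the image of z the derivative of the transported \<phi> contains
  the reciprocals of the tangential factors, while the divergence of X o P is taken at the squeezed
  point.\<close>

lemma flow_weak_identity:
  assumes \<phi>: "C1_on \<phi> UNIV" and K: "compact K" "K \<subseteq> T" "\<And>z. z \<notin> K \<Longrightarrow> \<phi> z = 0"
    and X: "C1_on (\<lambda>z. X (P z)) W" "\<And>x. x \<in> \<Gamma> \<Longrightarrow> X x \<bullet> n x = 0"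
    and \<tau>: "0 < \<tau>" "\<tau> \<le> 1"
  shows "((\<lambda>z. flow_factor \<kappa>2 \<tau> z * (X (P z) \<bullet> t1 (P z)) * (t1 (P z) \<bullet> gradient \<phi> z)
           + flow_factor \<kappa>1 \<tau> z * (X (P z) \<bullet> t2 (P z)) * (t2 (P z) \<bullet> gradient \<phi> z)
           + flow_factor \<kappa>1 \<tau> z * flow_factor \<kappa>2 \<tau> z * \<phi> z * divergence (\<lambda>z. X (P z)) (flow \<tau> z))
         has_integral 0) T" (is "(?I has_integral 0) T")
proof -
  let ?Y = "\<lambda>z. X (P z)"
  define S where "S = {y. \<bar>d y\<bar> < \<tau> * \<epsilon>}"
  have S: "open S"
    unfolding S_def by (intro open_Collect_less continuous_intros continuous_on_signed_dist)
  have "\<tau> * \<epsilon> \<le> \<epsilon>" using \<tau> \<epsilon>_pos by (intro mult_left_le_one_le) auto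
  then have ST: "S \<subseteq> T" unfolding S_def tube_def by (intro Collect_mono impI) (erule less_le_trans)
  have SW: "S \<subseteq> W" using ST tube_subset_W by blast
  have in1: "\<bar>\<tau> * d z\<bar> < \<epsilon>" if "z \<in> T" for z
    using that \<tau> mult_left_le_one_le[of "\<bar>d z\<bar>" \<tau>] by (simp add: abs_mult tube_def)
  have in2: "\<bar>1 / \<tau> * d y\<bar> < \<epsilon>" if "y \<in> S" for y
    using that \<tau> by (simp add: S_def abs_mult field_simps)
  have flow_S: "flow \<tau> z \<in> S" if "z \<in> T" for z
    using signed_dist_flow[OF in1[OF that]] that \<tau> by (simp add: S_def tube_def abs_mult)
  have inv1: "flow (1 / \<tau>) (flow \<tau> z) = z" if "z \<in> T" for z
    using flow_flow[OF in1[OF that]] \<tau> by simp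
  have inv2: "flow \<tau> (flow (1 / \<tau>) y) = y" if "y \<in> S" for y
    using flow_flow[OF in2[OF that]] \<tau> by simp
  \<comment> \<open>Extension by zero stays C^1: Z already vanishes off C, a compact subset of S,
    and the open sets S and - C cover the space.\<close>
  define Z where "Z y = (if y \<in> S then \<phi> (flow (1 / \<tau>) y) *\<^sub>R ?Y y else 0)" for y
  define C where "C = flow \<tau> ` K"
  have C: "compact C"
    unfolding C_def
    using compact_continuous_image[OF _ K(1)] C1_on_imp_continuous_on[OF flow_C1] K(2) tube_subset_W
      continuous_on_subset by blast
  have ZC: "Z y = 0" if "y \<notin> C" for y
  proof (cases "y \<in> S")
    case True
    then have "flow (1 / \<tau>) y \<notin> K" using that inv2[OF True] unfolding C_def by (metis image_eqI)
    then show ?thesis using K(3) by (simp add: Z_def)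
  qed (simp add: Z_def)
  have C1S: "C1_on (\<lambda>y. \<phi> (flow (1 / \<tau>) y) *\<^sub>R ?Y y) S"
    by (intro C1_on_scaleR C1_on_compose[OF C1_on_subset[OF flow_C1 SW] \<phi>] C1_on_subset[OF X(1) SW]) simp
  have CZ: "C1_on Z UNIV"
  proof (rule C1_on_local)
    fix y
    show "\<exists>V g. open V \<and> y \<in> V \<and> C1_on g V \<and> (\<forall>x\<in>V. g x = Z x)"
    proof (cases "y \<in> S")
      case True
      then show ?thesis
        using S C1S by (intro exI[of _ S] exI[of _ "\<lambda>y. \<phi> (flow (1 / \<tau>) y) *\<^sub>R ?Y y"]) (simp add: Z_def)
    next
      case False
      have "C \<subseteq> S" using flow_S K(2) by (auto simp: C_def)
      then show ?thesis
        using False compact_imp_closed[OF C] ZC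
        by (intro exI[of _ "- C"] exI[of _ "\<lambda>_. 0"]) (auto intro: C1_on_const)
    qed
  qed
  have inj: "inj_on (flow \<tau>) T" using inv1 by (metis inj_onI)
  let ?F = "\<lambda>z h. (flow_factor \<kappa>1 \<tau> z * (h \<bullet> t1 (P z))) *\<^sub>R t1 (P z) +
      (flow_factor \<kappa>2 \<tau> z * (h \<bullet> t2 (P z))) *\<^sub>R t2 (P z) + (\<tau> * (h \<bullet> n z)) *\<^sub>R n z"
  have TcT: "z \<in> closure T" if "z \<in> T" for z using that closure_subset by blast
  have outside: "divergence Z y = 0" if "y \<notin> flow \<tau> ` T" for y
    by (rule divergence_eq_0[OF compact_imp_closed[OF C] ZC]) (use that K(2) C_def in auto)
  have int0: "((\<lambda>z. \<bar>det (matrix (?F z))\<bar> * divergence Z (flow \<tau> z)) has_integral 0) T"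
    by (rule has_integral_zero_change_of_variables[OF
          integral_divergence_compact_support[OF CZ C ZC] outside open_tube inj
          flow_has_derivative[OF TcT]])
  have "((\<lambda>z. \<tau> * ?I z) has_integral 0) T"
  proof (rule has_integral_eq[OF _ int0])
    fix z assume z: "z \<in> T"
    let ?y = "flow \<tau> z" and ?a = "t1 (P z)" and ?b = "t2 (P z)" and ?X = "X (P z)"
      and ?l1 = "flow_factor \<kappa>1 \<tau> z" and ?l2 = "flow_factor \<kappa>2 \<tau> z" and ?g = "gradient \<phi> z"
    have yS: "?y \<in> S" by (rule flow_S[OF z])
    then have yT: "?y \<in> closure T" and yW: "?y \<in> W" using ST SW TcT by auto
    have Py: "P ?y = P z" by (rule proj_flow[OF in1[OF z]])
    have zW: "z \<in> W" using z tube_subset_W by blast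
    have l: "?l1 > 0" "?l2 > 0" using flow_factor_pos[OF z] \<tau> by auto
    have "(\<phi> has_derivative (\<lambda>h. h \<bullet> ?g)) (at (flow (1 / \<tau>) ?y))"
      using GDERIV_gradient[OF C1_on_differentiable[OF \<phi>]] inv1[OF z] by (simp add: gderiv_def)
    from has_derivative_compose[OF flow_has_derivative[OF yT] this]
    have der: "((\<lambda>y. \<phi> (flow (1 / \<tau>) y)) has_derivative (\<lambda>h. ((inverse ?l1 * (h \<bullet> ?a)) *\<^sub>R ?a +
        (inverse ?l2 * (h \<bullet> ?b)) *\<^sub>R ?b + (1 / \<tau> * (h \<bullet> n ?y)) *\<^sub>R n ?y) \<bullet> ?g)) (at ?y)"
      unfolding flow_factor_inverse[OF z \<tau>] Py .
    have Xn: "?X \<bullet> n ?y = 0"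
      using X(2)[OF proj_in_surface[of z]] normal_proj[OF yW] Py by simp
    have "divergence Z ?y = divergence (\<lambda>y. \<phi> (flow (1 / \<tau>) y) *\<^sub>R ?Y y) ?y"
      by (rule divergence_transform_open[OF C1S S yS]) (simp add: Z_def)
    also have "\<dots> = inverse ?l1 * (?X \<bullet> ?a) * (?a \<bullet> ?g) + inverse ?l2 * (?X \<bullet> ?b) * (?b \<bullet> ?g)
        + \<phi> z * divergence ?Y ?y"
      using divergence_scaleR[OF der C1_on_differentiable[OF X(1) yW]] Xn
      by (simp add: Py inv1[OF z] inner_add_left)
    finally have dZ: "divergence Z ?y = inverse ?l1 * (?X \<bullet> ?a) * (?a \<bullet> ?g)
        + inverse ?l2 * (?X \<bullet> ?b) * (?b \<bullet> ?g) + \<phi> z * divergence ?Y ?y" .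
    \<comment> \<open>The determinant turns the reciprocals of \<open>?l1\<close> and
      \<open>?l2\<close> into \<open>?l2\<close> and \<open>?l1\<close>, so each tangential term
      ends up with the factor of the other direction.\<close>
    have "\<bar>det (matrix (?F z))\<bar> = ?l1 * ?l2 * \<tau>"
      unfolding det_flow[OF TcT[OF z]] using l \<tau> by (simp add: abs_mult)
    then show "\<bar>det (matrix (?F z))\<bar> * divergence Z (flow \<tau> z) = \<tau> * ?I z"
      unfolding dZ using l by (simp add: field_simps)
  qed
  from has_integral_mult_right[OF this, of "1 / \<tau>"] show ?thesis using \<tau> by simp
qed

end

section \<open>The weak identity and the Neumann condition\<close>

lemma set_integrable_compact_support:
  fixes f :: "'a::euclidean_space \<Rightarrow> real"
  assumes "compact K" "K \<subseteq> S" "continuous_on K f" "\<And>z. z \<notin> K \<Longrightarrow> f z = 0"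
  shows "set_integrable lborel S f"
proof -
  have "(\<lambda>x. indicator S x *\<^sub>R f x) = (\<lambda>x. indicator K x *\<^sub>R f x)"
    using assms(2,4) by (auto simp: indicator_def fun_eq_iff)
  then show ?thesis
    using borel_integrable_compact[OF assms(1,3)] by (simp add: set_integrable_def)
qed

lemma gradient_eq_0_outside:
  assumes "closed K" "\<And>z. z \<notin> K \<Longrightarrow> \<phi> z = 0" "z \<notin> K"
  shows "gradient \<phi> z = 0"
proof (rule gradient_eqI)
  have "(\<phi> has_derivative (\<lambda>_. 0)) (at z)"
    by (rule has_derivative_transform_within_open[where f = "\<lambda>_. 0" and s = "- K"])
      (use assms in auto)
  then show "GDERIV \<phi> z :> 0" by (simp add: gderiv_def)
qed

text \<open>At a boundary point of the tube a derivative within the closure is determined at first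
  only in directions along which a short segment stays inside.\<close>

lemma has_derivative_within_unique_direction:
  fixes f :: "'a::real_normed_vector \<Rightarrow> 'b::real_normed_vector"
  assumes D: "(f has_derivative D1) (at z within S)" "(f has_derivative D2) (at z within S)"
    and S: "0 < e" "\<And>t. 0 \<le> t \<Longrightarrow> t \<le> e \<Longrightarrow> z + t *\<^sub>R h \<in> S"
  shows "D1 h = D2 h"
proof -
  have ne: "at 0 within {0..e} \<noteq> bot"
    using S(1) by (simp add: at_within_Icc_at_right trivial_limit_at_right_real)
  have "((\<lambda>t. f (z + t *\<^sub>R h)) has_vector_derivative D h) (at 0 within {0..e})"
    if D: "(f has_derivative D) (at z within S)" for D
  proof -
    have l: "((\<lambda>t. z + t *\<^sub>R h) has_derivative (\<lambda>t. t *\<^sub>R h)) (at 0 within {0..e})"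
      by (auto intro!: derivative_eq_intros)
    have "(f has_derivative D) (at (z + 0 *\<^sub>R h) within (\<lambda>t. z + t *\<^sub>R h) ` {0..e})"
      using D S(2) by (auto intro: has_derivative_subset)
    from has_derivative_in_compose[OF l this]
    show ?thesis
      by (simp add: has_vector_derivative_def linear_scale[OF has_derivative_linear[OF D]])
  qed
  then show ?thesis using vector_derivative_unique_within[OF ne] D by blast
qed

context C2_domain
begin

lemma surf_grad_cong:
  assumes "x \<in> \<Gamma>" "\<And>y. y \<in> \<Gamma> \<Longrightarrow> f y = g y"
  shows "surf_grad \<Omega> f x = surf_grad \<Omega> g x"
proof -
  have "(f has_derivative D) (at x within \<Gamma>) \<longleftrightarrow> (g has_derivative D) (at x within \<Gamma>)" for D
    using has_derivative_transform[OF assms(1), of f g D] has_derivative_transform[OF assms(1), of g f D]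
      assms(2) by metis
  then show ?thesis unfolding surf_grad_def by simp
qed

text \<open>All surface notions depend on the values on \<Gamma> only. This transfers the equation
  from u to v, whose values off the surface need not agree with those of u.\<close>

lemma surface_solution_cong:
  assumes u: "surface_solution \<Omega> L u" and eq: "\<And>x. x \<in> \<Gamma> \<Longrightarrow> v x = u x"
  shows "surface_solution \<Omega> L v"
proof -
  have sg: "surf_grad \<Omega> v x = surf_grad \<Omega> u x" if "x \<in> \<Gamma>" for x
    using surf_grad_cong[OF that eq] .
  have "surf_div \<Omega> (\<lambda>y. L_p L y (v y) (surf_grad \<Omega> v y)) x =
      surf_div \<Omega> (\<lambda>y. L_p L y (u y) (surf_grad \<Omega> u y)) x" if "x \<in> \<Gamma>" for x
    unfolding surf_div_def
    by (intro sum.cong refl arg_cong[of _ _ "\<lambda>w. w $ _"] surf_grad_cong[OF that]) (simp add: eq sg)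
  moreover have "Ck_on 2 v \<Gamma>"
    unfolding Ck_on_def
  proof
    fix x assume "x \<in> \<Gamma>"
    moreover have "Ck_on 2 u \<Gamma>" using u by (simp add: surface_solution_def)
    ultimately obtain U F where "open U" "x \<in> U" "Ck_open 2 F U" "\<And>y. y \<in> U \<Longrightarrow> y \<in> \<Gamma> \<Longrightarrow> F y = u y"
      using Ck_onE by metis
    then show "\<exists>U F. open U \<and> x \<in> U \<and> Ck_open 2 F U \<and> (\<forall>y\<in>U \<inter> \<Gamma>. F y = v y)"
      using eq by (intro exI[of _ U] exI[of _ F]) simp
  qed
  ultimately show ?thesis using u sg eq unfolding surface_solution_def by simp
qed

end

context tubular_neighbourhood
begin

text \<open>As \<tau> tends to 0 the tangential factors tend to \<sigma>1 and \<sigma>2, and the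
  squeezed point tends to P z, which moves the divergence onto \<Gamma>. The crossed coefficients
  \<sigma>2 and \<sigma>1 are exactly the entries \<sigma>1 \<sigma>2 / \<sigma>_i of J A in the
  directions t1 and t2.\<close>

lemma tube_weak_identity:
  assumes \<phi>: "C1_on \<phi> UNIV" "continuous_on UNIV (gradient \<phi>)"
    and K: "compact K" "K \<subseteq> T" "\<And>z. z \<notin> K \<Longrightarrow> \<phi> z = 0"
    and X: "C1_on (\<lambda>z. X (P z)) W" "\<And>x. x \<in> \<Gamma> \<Longrightarrow> X x \<bullet> n x = 0"
  shows "((\<lambda>z. (Jac \<Omega> \<kappa>1 \<kappa>2 z *\<^sub>R (Amat \<Omega> t1 t2 \<kappa>1 \<kappa>2 \<mu> z *v X (P z))) \<bullet> gradient \<phi> z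
           + Jac \<Omega> \<kappa>1 \<kappa>2 z * divergence (\<lambda>z. X (P z)) (P z) * \<phi> z) has_integral 0) T"
proof -
  let ?Y = "\<lambda>z. X (P z)"
  define \<tau> where "\<tau> k = inverse (real (Suc k))" for k
  have \<tau>: "0 < \<tau> k" "\<tau> k \<le> 1" for k by (auto simp: \<tau>_def field_simps)
  have \<tau>_lim: "\<tau> \<longlonglongrightarrow> 0" unfolding \<tau>_def by (rule LIMSEQ_inverse_real_of_nat)
  have bdd: "\<exists>M\<ge>0. \<forall>x\<in>S. norm (f x) \<le> M" if c: "compact S" "continuous_on S f"
    for S :: "(real^3) set" and f :: "real^3 \<Rightarrow> 'b::real_normed_vector"
  proof -
    obtain M where "M > 0" "\<forall>y\<in>f ` S. norm y \<le> M"
      using compact_imp_bounded[OF compact_continuous_image[OF c(2,1)]] unfolding bounded_pos by blast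
    then show ?thesis by (intro exI[of _ M]) auto
  qed
  have TcT: "z \<in> closure T" if "z \<in> T" for z using that closure_subset by blast
  obtain M1 where "M1 \<ge> 0" "\<forall>x\<in>\<Gamma>. norm (X (P x)) \<le> M1"
    using bdd[OF compact_surface continuous_on_subset[OF C1_on_imp_continuous_on[OF X(1)] surface_subset_W]]
    by blast
  then have M1: "M1 \<ge> 0" "norm (X (P z)) \<le> M1" for z
    using proj_in_surface[of z] proj_proj[of z] by force+
  obtain M2 where "M2 \<ge> 0" "\<forall>z\<in>K. norm (gradient \<phi> z) \<le> M2"
    using bdd[OF K(1) continuous_on_subset[OF \<phi>(2) subset_UNIV]] by blast
  then have M2: "M2 \<ge> 0" "norm (gradient \<phi> z) \<le> M2" for z
    using gradient_eq_0_outside[where z = z, OF compact_imp_closed[OF K(1)] K(3)] by (cases "z \<in> K"; simp)+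
  obtain M3 where "M3 \<ge> 0" "\<forall>z\<in>K. norm (\<phi> z) \<le> M3"
    using bdd[OF K(1) continuous_on_subset[OF C1_on_imp_continuous_on[OF \<phi>(1)] subset_UNIV]] by blast
  then have M3: "M3 \<ge> 0" "norm (\<phi> z) \<le> M3" for z
    using K(3)[of z] by (cases "z \<in> K"; simp)+
  have cdiv: "continuous_on W (divergence ?Y)"
    using continuous_on_divergence[OF X(1) continuous_on_id] by simp
  obtain M4 where M4: "M4 \<ge> 0" "\<And>z. z \<in> closure T \<Longrightarrow> norm (divergence ?Y z) \<le> M4"
    using bdd[OF compact_closure_tube continuous_on_subset[OF cdiv closure_tube_subset_W]] by blast
  \<comment> \<open>\<sigma>_i is at most 1 / (1 - \<epsilon> \<kappa>_max), and 1 + s d \<kappa>_i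
    is at most 1 + \<epsilon> \<kappa>_max, hence at most 2.\<close>
  define C where "C = 2 * inverse (1 - \<epsilon> * \<kappa>_max)"
  have C0: "C \<ge> 0" using \<epsilon>_small by (simp add: C_def)
  have small: "\<bar>s * d z\<bar> < \<epsilon>" if "z \<in> T" "0 \<le> s" "s \<le> 1" for z s
    using that mult_left_le_one_le[of "\<bar>d z\<bar>" s] by (simp add: abs_mult tube_def)
  have fac: "\<bar>flow_factor \<kappa>1 s z\<bar> \<le> C" "\<bar>flow_factor \<kappa>2 s z\<bar> \<le> C" if z: "z \<in> T" "0 \<le> s" "s \<le> 1" for z s
  proof -
    have k: "\<bar>s * d z * \<kappa>1 (P z)\<bar> \<le> \<epsilon> * \<kappa>_max" "\<bar>s * d z * \<kappa>2 (P z)\<bar> \<le> \<epsilon> * \<kappa>_max"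
      using curvature_bound[OF proj_in_surface, of z] small[OF z] \<epsilon>_pos
      unfolding abs_mult[of "s * d z"] by (auto intro!: mult_mono)
    have "\<sigma>1 z * (1 + s * d z * \<kappa>1 (P z)) \<le> inverse (1 - \<epsilon> * \<kappa>_max) * 2"
      "\<sigma>2 z * (1 + s * d z * \<kappa>2 (P z)) \<le> inverse (1 - \<epsilon> * \<kappa>_max) * 2"
      using k \<epsilon>_small sing_val_le[OF TcT[OF z(1)]] sing_val_pos[OF TcT[OF z(1)]]
      by (intro mult_mono; linarith)+
    then show "\<bar>flow_factor \<kappa>1 s z\<bar> \<le> C" "\<bar>flow_factor \<kappa>2 s z\<bar> \<le> C"
      using flow_factor_pos[OF z] by (simp_all add: flow_factor_def C_def)
  qed
  define I where "I k z = flow_factor \<kappa>2 (\<tau> k) z * (X (P z) \<bullet> t1 (P z)) * (t1 (P z) \<bullet> gradient \<phi> z)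
           + flow_factor \<kappa>1 (\<tau> k) z * (X (P z) \<bullet> t2 (P z)) * (t2 (P z) \<bullet> gradient \<phi> z)
           + flow_factor \<kappa>1 (\<tau> k) z * flow_factor \<kappa>2 (\<tau> k) z * \<phi> z * divergence ?Y (flow (\<tau> k) z)"
    for k z
  define B where "B = C * M1 * M2 + C * M1 * M2 + C * C * M3 * M4"
  show ?thesis
  proof (rule has_integral_dominated_convergence[where f = I and y = "\<lambda>_. 0" and h = "\<lambda>_. B"])
    show "(I k has_integral 0) T" for k
      unfolding I_def by (rule flow_weak_identity[OF \<phi>(1) K X \<tau>])
    show "(\<lambda>_. B) integrable_on T"
      by (rule integrable_on_const) (use bounded_tube open_tube lmeasurable_open in blast)
    show "\<forall>z\<in>T. norm (I k z) \<le> B" for k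
    proof
      fix z assume z: "z \<in> T"
      have zW: "z \<in> W" using z tube_subset_W by blast
      have inn: "\<bar>X (P z) \<bullet> t1 (P z)\<bar> \<le> M1" "\<bar>X (P z) \<bullet> t2 (P z)\<bar> \<le> M1"
        "\<bar>t1 (P z) \<bullet> gradient \<phi> z\<bar> \<le> M2" "\<bar>t2 (P z) \<bullet> gradient \<phi> z\<bar> \<le> M2"
        using Cauchy_Schwarz_ineq2[of "X (P z)" "t1 (P z)"] Cauchy_Schwarz_ineq2[of "X (P z)" "t2 (P z)"]
          Cauchy_Schwarz_ineq2[of "t1 (P z)" "gradient \<phi> z"] Cauchy_Schwarz_ineq2[of "t2 (P z)" "gradient \<phi> z"]
          M1(2)[of z] M2(2)[of z] frame_at[OF zW] by simp_all
      have dv: "\<bar>divergence ?Y (flow (\<tau> k) z)\<bar> \<le> M4"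
        using M4(2)[OF TcT[OF flow_in_tube[OF small[OF z]]], of "\<tau> k"] \<tau>[of k] by simp
      have f: "\<bar>flow_factor \<kappa>1 (\<tau> k) z\<bar> \<le> C" "\<bar>flow_factor \<kappa>2 (\<tau> k) z\<bar> \<le> C"
        using fac[OF z, of "\<tau> k"] \<tau>[of k] by auto
      have ph: "\<bar>\<phi> z\<bar> \<le> M3" using M3(2)[of z] by simp
      have "norm (I k z) \<le> \<bar>flow_factor \<kappa>2 (\<tau> k) z * (X (P z) \<bullet> t1 (P z)) * (t1 (P z) \<bullet> gradient \<phi> z)\<bar>
         + \<bar>flow_factor \<kappa>1 (\<tau> k) z * (X (P z) \<bullet> t2 (P z)) * (t2 (P z) \<bullet> gradient \<phi> z)\<bar>
         + \<bar>flow_factor \<kappa>1 (\<tau> k) z * flow_factor \<kappa>2 (\<tau> k) z * \<phi> z * divergence ?Y (flow (\<tau> k) z)\<bar>"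
        unfolding I_def real_norm_def by linarith
      also have "\<dots> \<le> B"
        unfolding B_def abs_mult
        by (intro add_mono mult_mono inn dv f ph mult_nonneg_nonneg abs_ge_zero C0 M1(1) M2(1) M3(1) M4(1))
      finally show "norm (I k z) \<le> B" .
    qed
    show "\<forall>z\<in>T. (\<lambda>k. I k z) \<longlonglongrightarrow>
        (Jac \<Omega> \<kappa>1 \<kappa>2 z *\<^sub>R (Amat \<Omega> t1 t2 \<kappa>1 \<kappa>2 \<mu> z *v X (P z))) \<bullet> gradient \<phi> z
           + Jac \<Omega> \<kappa>1 \<kappa>2 z * divergence ?Y (P z) * \<phi> z"
    proof
      fix z assume z: "z \<in> T"
      have zW: "z \<in> W" using z tube_subset_W by blast
      let ?a = "t1 (P z)" and ?b = "t2 (P z)" and ?X = "X (P z)" and ?g = "gradient \<phi> z"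
      have l: "(\<lambda>k. flow_factor \<kappa> (\<tau> k) z) \<longlonglongrightarrow> sing_val \<Omega> \<kappa> z" for \<kappa>
        unfolding flow_factor_def using \<tau>_lim by (auto intro!: tendsto_eq_intros)
      have "(\<lambda>k. flow (\<tau> k) z) \<longlonglongrightarrow> P z"
        unfolding flow_def using \<tau>_lim by (auto intro!: tendsto_eq_intros)
      moreover have "flow (\<tau> k) z \<in> W" for k
        using flow_in_tube[OF small[OF z]] \<tau>[of k] tube_subset_W by auto
      ultimately have dv: "(\<lambda>k. divergence ?Y (flow (\<tau> k) z)) \<longlonglongrightarrow> divergence ?Y (P z)"
        by (intro continuous_on_tendsto_compose[OF cdiv] proj_in_W) auto
      have "(\<lambda>k. I k z) \<longlonglongrightarrow> \<sigma>2 z * (?X \<bullet> ?a) * (?a \<bullet> ?g) + \<sigma>1 z * (?X \<bullet> ?b) * (?b \<bullet> ?g)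
          + \<sigma>1 z * \<sigma>2 z * \<phi> z * divergence ?Y (P z)"
        unfolding I_def by (intro tendsto_add tendsto_mult tendsto_const l dv)
      moreover have "?X \<bullet> n z = 0"
        using X(2)[OF proj_in_surface[of z]] normal_proj[OF zW] by simp
      then have "(Jac \<Omega> \<kappa>1 \<kappa>2 z *\<^sub>R (Amat \<Omega> t1 t2 \<kappa>1 \<kappa>2 \<mu> z *v ?X)) \<bullet> ?g =
          \<sigma>2 z * (?X \<bullet> ?a) * (?a \<bullet> ?g) + \<sigma>1 z * (?X \<bullet> ?b) * (?b \<bullet> ?g)"
        using sing_val_pos[OF TcT[OF z]]
        by (simp add: Amat_mult_vec Jac_def inner_add_left field_simps)
      ultimately show "(\<lambda>k. I k z) \<longlonglongrightarrow>
          (Jac \<Omega> \<kappa>1 \<kappa>2 z *\<^sub>R (Amat \<Omega> t1 t2 \<kappa>1 \<kappa>2 \<mu> z *v ?X)) \<bullet> ?g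
           + Jac \<Omega> \<kappa>1 \<kappa>2 z * divergence ?Y (P z) * \<phi> z"
        by (simp add: Jac_def mult_ac)
    qed
  qed simp
qed

text \<open>Segments in strictly inward directions stay in the closed tube, so any derivative within
  it agrees there with the full one. These directions form an open half space, which spans.\<close>

lemma gradient_within_closure_tube:
  assumes z: "z \<in> frontier T" and w: "(w has_derivative (\<lambda>h. h \<bullet> g)) (at z)"
  shows "gradient_within w z (closure T) = g"
  unfolding gradient_within_def
proof (rule the_equality)
  show wg: "(w has_derivative (\<lambda>h. h \<bullet> g)) (at z within closure T)"
    using w by (rule has_derivative_at_withinI)
  fix q assume q: "(w has_derivative (\<lambda>h. h \<bullet> q)) (at z within closure T)"
  have zc: "z \<in> closure T" using z by (simp add: frontier_def)
  then have zW: "z \<in> W" using closure_tube_subset_W by blast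
  have "z \<notin> T" using z open_tube by (simp add: frontier_def interior_open)
  then have dz: "\<bar>d z\<bar> = \<epsilon>" using closure_tube_le[OF zc] by (simp add: tube_def)
  \<comment> \<open>The outward normal of the tube: n on the outer boundary, where d = \<epsilon>,
    and -n on the inner one, where d = -\<epsilon>.\<close>
  define m where "m = sgn (d z) *\<^sub>R n z"
  have m1: "m \<bullet> m = 1"
    using norm_normal[OF zW] dz \<epsilon>_pos by (auto simp: m_def sgn_if norm_eq_1)
  have half: "h \<bullet> q = h \<bullet> g" if h: "h \<bullet> m < 0" for h
  proof -
    let ?f = "\<lambda>t. sgn (d z) * d (z + t *\<^sub>R h)"
    have "((\<lambda>t. z + t *\<^sub>R h) has_derivative (\<lambda>t. t *\<^sub>R h)) (at 0)" by (auto intro!: derivative_eq_intros)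
    moreover have "(d has_derivative (\<lambda>h. h \<bullet> n z)) (at (z + 0 *\<^sub>R h))"
      using signed_dist_gderiv[OF zW] by (simp add: gderiv_def)
    ultimately have "((\<lambda>t. d (z + t *\<^sub>R h)) has_derivative (\<lambda>t. (t *\<^sub>R h) \<bullet> n z)) (at 0)"
      by (rule has_derivative_compose)
    then have "(?f has_derivative (\<lambda>t. sgn (d z) * ((t *\<^sub>R h) \<bullet> n z))) (at 0)"
      by (rule has_derivative_mult_right)
    then have der: "(?f has_real_derivative (h \<bullet> m)) (at 0)"
      by (simp add: has_field_derivative_def m_def mult_commute_abs mult.left_commute mult.assoc)
    obtain e1 where e1: "e1 > 0" "\<And>t. t > 0 \<Longrightarrow> t < e1 \<Longrightarrow> ?f t < ?f 0"
      using DERIV_neg_dec_right[OF der h] by auto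
    have f0: "?f 0 = \<epsilon>" using dz by (simp add: abs_sgn mult.commute)
    \<comment> \<open>Positivity of \<open>?f\<close> keeps the sign of d constant along the
      segment, so that the upper bound on \<open>?f\<close> is a bound on |d|.\<close>
    have "isCont ?f 0" using der DERIV_isCont by blast
    then have "\<forall>\<^sub>F t in at 0. ?f t > 0"
      using f0 \<epsilon>_pos unfolding isCont_def by (intro order_tendstoD(1)) auto
    then obtain e2 where e2: "e2 > 0" "\<And>t. t \<noteq> 0 \<Longrightarrow> \<bar>t\<bar> < e2 \<Longrightarrow> ?f t > 0"
      unfolding eventually_at by (auto simp: dist_real_def)
    define e where "e = min e1 e2 / 2"
    have e: "e > 0" "e < e1" "e < e2" using e1(1) e2(1) by (auto simp: e_def)
    have "z + t *\<^sub>R h \<in> closure T" if t: "0 \<le> t" "t \<le> e" for t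
    proof (cases "t = 0")
      case True then show ?thesis using zc by simp
    next
      case False
      then have "?f t < \<epsilon>" "?f t > 0" using e1(2)[of t] e2(2)[of t] t e f0 by auto
      moreover have "\<bar>?f t\<bar> = \<bar>d (z + t *\<^sub>R h)\<bar>"
        using dz \<epsilon>_pos by (auto simp: abs_mult sgn_if)
      ultimately have "z + t *\<^sub>R h \<in> T" by (simp add: tube_def)
      then show ?thesis using closure_subset by blast
    qed
    then show ?thesis by (rule has_derivative_within_unique_direction[OF q wg e(1)])
  qed
  have "(- m) \<bullet> q = (- m) \<bullet> g" by (rule half) (simp add: m1)
  then have mr: "m \<bullet> (q - g) = 0" by (simp add: inner_diff_right)
  \<comment> \<open>Subtracting m pushes q - g, which is orthogonal to m, into the inward half space
    without changing its inner product with q - g.\<close>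
  have "((q - g) - m) \<bullet> m < 0" using mr m1 by (simp add: inner_diff_left inner_diff_right inner_commute)
  then have "((q - g) - m) \<bullet> q = ((q - g) - m) \<bullet> g" by (rule half)
  then have "((q - g) - m) \<bullet> (q - g) = 0" by (simp only: inner_diff_right)
  then have "(q - g) \<bullet> (q - g) = 0" using mr by (simp only: inner_diff_left[of "q - g" m])
  then show "q = g" by simp
qed

text \<open>The surface gradient is tangential, so the hypothesis on L_p makes X a tangential field,
  as the weak identity requires. The surface equation then turns the divergence of X o P on \<Gamma>
  into L_q.\<close>

theorem extended_solution_comp_proj:
  assumes L_C2: "Ck_on 2 (\<lambda>(x, q, p). L x q p) (\<Gamma> \<times> UNIV \<times> UNIV)"
    and L_p_tangential: "\<And>x q t. x \<in> \<Gamma> \<Longrightarrow> t \<bullet> n x = 0 \<Longrightarrow> L_p L x q t \<bullet> n x = 0"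
    and u: "surface_solution \<Omega> L u"
  shows "extended_solution \<Omega> \<epsilon> t1 t2 \<kappa>1 \<kappa>2 \<mu> L (\<lambda>z. u (P z))"
proof -
  let ?w = "\<lambda>z. u (P z)" and ?J = "Jac \<Omega> \<kappa>1 \<kappa>2" and ?A = "Amat \<Omega> t1 t2 \<kappa>1 \<kappa>2 \<mu>"
  define X where "X y = L_p L y (u y) (surf_grad \<Omega> u y)" for y
  have u2: "Ck_on 2 u \<Gamma>" using u by (simp add: surface_solution_def)
  note wC = comp_proj_C1[OF u2]
  have XC: "C1_on (\<lambda>z. X (P z)) W"
    unfolding X_def by (rule L_p_comp_proj_C1[OF L_C2 wC surf_grad_comp_proj_C1[OF u2]])
  have TcT: "z \<in> closure T" if "z \<in> T" for z using that closure_subset by blast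
  have Xt: "X x \<bullet> n x = 0" if "x \<in> \<Gamma>" for x
  proof -
    have "?w differentiable at x" using C1_on_differentiable[OF wC] that surface_subset_W by blast
    then show ?thesis
      unfolding X_def using that gradient_comp_proj_tangent[OF that] surf_grad_eq_gradient[OF that]
      by (intro L_p_tangential) simp_all
  qed
  have XtP: "X (P z) \<bullet> n z = 0" if "z \<in> closure T" for z
    using Xt[OF proj_in_surface[of z]] normal_proj that closure_tube_subset_W by auto
  \<comment> \<open>F and G coincide on T with the two fields of the equation but are continuous on
    the closure, which provides all integrability.\<close>
  define F where "F z = ?J z *\<^sub>R (?A z *v X (P z))" for z
  define G where "G z = ?J z * divergence (\<lambda>z. X (P z)) (P z)" for z
  have F_eq: "?J z *\<^sub>R (?A z *v L_p L (P z) (?w z) (?A z *v gradient ?w z)) = F z" if "z \<in> T" for z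
    using gradient_comp_proj(2)[OF TcT[OF that] wC] by (simp add: F_def X_def)
  have G_eq: "?J z * L_q L (P z) (?w z) (?A z *v gradient ?w z) = G z" if "z \<in> T" for z
  proof -
    have "surf_div \<Omega> X (P z) = L_q L (P z) (?w z) (surf_grad \<Omega> u (P z))"
      using u proj_in_surface[of z] unfolding surface_solution_def X_def by force
    moreover have "surf_div \<Omega> X (P z) = divergence (\<lambda>z. X (P z)) (P z)"
      by (rule surf_div_eq_divergence[OF proj_in_surface C1_on_differentiable[OF XC proj_in_W]])
    ultimately show ?thesis
      using gradient_comp_proj(2)[OF TcT[OF that] wC] by (simp add: G_def)
  qed
  have cP: "continuous_on (closure T) P"
    using continuous_on_subset[OF C1_on_imp_continuous_on[OF proj_C1] closure_tube_subset_W] .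
  have cX: "continuous_on (closure T) (\<lambda>z. X (P z))"
    using continuous_on_subset[OF C1_on_imp_continuous_on[OF XC] closure_tube_subset_W] .
  have cF: "continuous_on (closure T) F"
    unfolding F_def by (rule continuous_on_Jac_Amat[OF cX XtP])
  have cG: "continuous_on (closure T) G"
    unfolding G_def
    by (intro continuous_on_mult continuous_on_Jac continuous_on_divergence[OF XC cP])
      (use proj_in_W in auto)
  have weak: "has_weak_divergence
        (\<lambda>z. ?J z *\<^sub>R (?A z *v L_p L (P z) (?w z) (?A z *v gradient ?w z)))
        (\<lambda>z. ?J z * L_q L (P z) (?w z) (?A z *v gradient ?w z)) T" (is "has_weak_divergence ?F ?G T")
    unfolding has_weak_divergence_def
  proof (intro conjI allI impI; (elim conjE)?)
    fix K assume K: "compact K" "K \<subseteq> T"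
    have Kc: "K \<subseteq> closure T" using K(2) closure_subset by blast
    have "set_integrable lborel K F" "set_integrable lborel K G"
      using borel_integrable_compact[OF K(1) continuous_on_subset[OF cF Kc]]
        borel_integrable_compact[OF K(1) continuous_on_subset[OF cG Kc]]
      by (simp_all add: set_integrable_def)
    moreover have "set_integrable lborel K ?F \<longleftrightarrow> set_integrable lborel K F"
      "set_integrable lborel K ?G \<longleftrightarrow> set_integrable lborel K G"
      by (rule set_integrable_cong; use F_eq G_eq K(2) in blast)+
    ultimately show "set_integrable lborel K ?F" "set_integrable lborel K ?G" by blast+
  next
    fix \<phi> :: "real^3 \<Rightarrow> real" assume "test_function T \<phi>"
    then obtain K where Ck: "\<And>k. Ck_open k \<phi> UNIV" and K: "compact K" "K \<subseteq> T" "\<And>z. z \<notin> K \<Longrightarrow> \<phi> z = 0"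
      unfolding test_function_def by blast
    note \<phi> = Ck_open_2D[OF Ck[of 2] open_UNIV]
    have c\<phi>: "continuous_on UNIV (gradient \<phi>)" "continuous_on UNIV \<phi>"
      using C1_on_imp_continuous_on \<phi>(1,2) by blast+
    have Kc: "K \<subseteq> closure T" using K(2) closure_subset by blast
    have i1: "set_integrable lborel T (\<lambda>z. F z \<bullet> gradient \<phi> z)"
    proof (rule set_integrable_compact_support[OF K(1,2)])
      show "continuous_on K (\<lambda>z. F z \<bullet> gradient \<phi> z)"
        by (intro continuous_on_inner continuous_on_subset[OF cF Kc] continuous_on_subset[OF c\<phi>(1) subset_UNIV])
    qed (simp add: gradient_eq_0_outside[OF compact_imp_closed[OF K(1)] K(3)])
    have i2: "set_integrable lborel T (\<lambda>z. G z * \<phi> z)"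
    proof (rule set_integrable_compact_support[OF K(1,2)])
      show "continuous_on K (\<lambda>z. G z * \<phi> z)"
        by (intro continuous_on_mult continuous_on_subset[OF cG Kc] continuous_on_subset[OF c\<phi>(2) subset_UNIV])
    qed (simp add: K(3))
    have "((\<lambda>z. F z \<bullet> gradient \<phi> z + G z * \<phi> z) has_integral 0) T"
      unfolding F_def G_def by (rule tube_weak_identity[OF \<phi>(2) c\<phi>(1) K XC Xt])
    then have "integral T (\<lambda>z. F z \<bullet> gradient \<phi> z) + integral T (\<lambda>z. G z * \<phi> z) = 0"
      using integral_add[OF set_borel_integral_eq_integral(1)[OF i1] set_borel_integral_eq_integral(1)[OF i2]]
      by (simp add: integral_unique)
    then have "(LINT z:T|lborel. F z \<bullet> gradient \<phi> z) = - (LINT z:T|lborel. G z * \<phi> z)"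
      using set_borel_integral_eq_integral(2)[OF i1] set_borel_integral_eq_integral(2)[OF i2] by simp
    moreover have "(LINT z:T|lborel. ?F z \<bullet> gradient \<phi> z) = (LINT z:T|lborel. F z \<bullet> gradient \<phi> z)"
      "(LINT z:T|lborel. ?G z * \<phi> z) = (LINT z:T|lborel. G z * \<phi> z)"
      by (rule set_lebesgue_integral_cong, simp add: open_tube borel_open,
          intro allI impI, simp only: F_eq G_eq)+
    ultimately show "(LINT z:T|lborel. ?F z \<bullet> gradient \<phi> z) = - (LINT z:T|lborel. ?G z * \<phi> z)"
      by simp
  qed
  have neumann: "n z \<bullet> gradient_within ?w z (closure T) = 0" if z: "z \<in> frontier T" for z
  proof -
    have zc: "z \<in> closure T" using z by (simp add: frontier_def)
    then have zW: "z \<in> W" using closure_tube_subset_W by blast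
    have diff: "?w differentiable at z" using C1_on_differentiable[OF wC zW] .
    have g: "(?w has_derivative (\<lambda>h. h \<bullet> gradient ?w z)) (at z)"
      using GDERIV_gradient[OF diff] by (simp add: gderiv_def)
    \<comment> \<open>P is constant along normals to first order, also at boundary points, since the
      formula for P' holds on the closed tube.\<close>
    have "P' z (n z) = 0"
      using frame_at[OF zW] by (simp add: proj_derivative[OF zc] inner_commute)
    then have "n z \<bullet> gradient ?w z = 0"
      using fun_cong[OF has_derivative_unique[OF g gradient_comp_proj(1)[OF zc wC]], of "n z"] by simp
    then show ?thesis using gradient_within_closure_tube[OF z g] by simp
  qed
  have "Ck_on 1 ?w (closure T)"
    unfolding Ck_on_def Ck_open_1_iff_C1_on using open_W wC closure_tube_subset_W by blast
  then show ?thesis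
    unfolding extended_solution_def Let_def using weak neumann by blast
qed

end

theorem corollary2p5:
  fixes \<Omega> :: "(real^3) set"
    and \<epsilon> \<mu> \<kappa>_max :: real
    and t1 t2 :: "real^3 \<Rightarrow> real^3"
    and \<kappa>1 \<kappa>2 :: "real^3 \<Rightarrow> real"
    and L :: "real^3 \<Rightarrow> real \<Rightarrow> real^3 \<Rightarrow> real"
    and v :: "real^3 \<Rightarrow> real"
  assumes "open \<Omega>" and "bounded \<Omega>" and "\<Omega> \<noteq> {}" and "C2_boundary \<Omega>"
    and frame: "\<And>x. x \<in> frontier \<Omega> \<Longrightarrow> principal_frame \<Omega> x (t1 x) (t2 x) (\<kappa>1 x) (\<kappa>2 x)"
    and curvature_bound: "\<And>x. x \<in> frontier \<Omega> \<Longrightarrow> \<bar>\<kappa>1 x\<bar> \<le> \<kappa>_max \<and> \<bar>\<kappa>2 x\<bar> \<le> \<kappa>_max"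
    and "\<epsilon> > 0" and "\<epsilon> * \<kappa>_max < 1"
    and "proj_well_defined_on \<Omega> (closure (tube \<Omega> \<epsilon>))"
    and L_C2: "Ck_on 2 (\<lambda>(x, q, p). L x q p) (frontier \<Omega> \<times> UNIV \<times> UNIV)"
    and L_p_tangential: "\<And>x q t. x \<in> frontier \<Omega> \<Longrightarrow> t \<bullet> normal \<Omega> x = 0 \<Longrightarrow>
                           L_p L x q t \<bullet> normal \<Omega> x = 0"
    and solvable: "\<exists>u. surface_solution \<Omega> L u"
    and v_solution: "extended_solution \<Omega> \<epsilon> t1 t2 \<kappa>1 \<kappa>2 \<mu> L v"
    and v_unique: "\<And>w. extended_solution \<Omega> \<epsilon> t1 t2 \<kappa>1 \<kappa>2 \<mu> L w \<Longrightarrow>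
                     \<forall>z\<in>closure (tube \<Omega> \<epsilon>). w z = v z"
  shows "(\<forall>z\<in>tube \<Omega> \<epsilon>. v z = v (proj \<Omega> z)) \<and>
         surface_solution \<Omega> L v \<and>
         (\<forall>u. surface_solution \<Omega> L u \<longrightarrow> (\<forall>x\<in>frontier \<Omega>. u x = v x))"
proof -
  interpret tubular_neighbourhood \<Omega> \<epsilon> \<kappa>_max t1 t2 \<kappa>1 \<kappa>2
    by unfold_locales (use assms in auto)
  \<comment> \<open>Uniqueness is applied to u o P for an arbitrary surface solution u, so the same
    line gives uniqueness on \<Gamma>.\<close>
  have key: "u (proj \<Omega> z) = v z" if "surface_solution \<Omega> L u" "z \<in> closure (tube \<Omega> \<epsilon>)" for u z
    using v_unique[OF extended_solution_comp_proj[OF L_C2 L_p_tangential that(1)]] that(2) by simp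
  have in_tube: "x \<in> closure (tube \<Omega> \<epsilon>)" if "x \<in> frontier \<Omega>" for x
    using that surface_subset_tube[OF \<epsilon>_pos] closure_subset by blast
  have uv: "u x = v x" if "surface_solution \<Omega> L u" "x \<in> frontier \<Omega>" for u x
    using key[OF that(1) in_tube[OF that(2)]] that(2) by simp
  obtain u where u: "surface_solution \<Omega> L u" using solvable by blast
  have "v z = v (proj \<Omega> z)" if "z \<in> tube \<Omega> \<epsilon>" for z
    using key[OF u] uv[OF u proj_in_surface] that closure_subset by (metis subsetD)
  moreover have "surface_solution \<Omega> L v"
    by (rule surface_solution_cong[OF u]) (simp add: uv[OF u])
  ultimately show ?thesis using uv by blast
qed

end
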